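(* Let $N\ge2$, let $X_1,\dots,X_N$ be Polish spaces, $\rho_i\in\mathcal P(X_i)$ Borel probability measures, and $c:X_1\times\cdots\times X_N\to[0,+\infty]$ lower semicontinuous such that, for some $\mathcal K<+\infty$ and every $i=1,\dots,N$, $\sup_{x_i\in X_i}\int_{\prod_{j\ne i}X_j}c(x_1,\dots,x_N)\,d\bigotimes_{j\neq i}\rho_j\le\mathcal K$. Then for every $\varepsilon>0$ there exists an $N$-tuple $(u_1^\varepsilon,\dots,u_N^\varepsilon)$ maximizing $\mathcal D^N_\varepsilon$ over $L^1_{\rho_1}\times\cdots\times L^1_{\rho_N}$, and it is unique up to constants that sum to zero (i.e., up to a.e. equality, the maximizers are exactly the tuples $(u_1^\varepsilon+a_1,\dots,u_N^\varepsilon+a_N)$ with $a_i\in\mathbb R$, $\sum_{i=1}^N a_i=0$). Moreover, the plan $\bar\gamma_\varepsilon$ defined by $$d\bar\gamma_\varepsilon=e^{\frac{\sum_{i=1}^N u_i^\varepsilon(x_i)-c(x_1,\dots,x_N)}{\varepsilon}}\,d(\rho_1\otimes\cdots\otimes\rho_N)$$ belongs to $\Pi(\rho_1,\dots,\rho_N)$ and is the unique minimizer of $\mathcal C^N_\varepsilon$ over $\Pi(\rho_1,\dots,\rho_N)$.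
   Context: With $\rho^N=\rho_1\otimes\cdots\otimes\rho_N$ and $e^{-\infty}=0$, for $u_i\in L^1_{\rho_i}$, $$\mathcal D^N_\varepsilon(u_1,\dots,u_N)=\sum_{i=1}^N\int_{X_i}u_i\,d\rho_i-\varepsilon\int_{X_1\times\cdots\times X_N}e^{\frac{\sum_{i=1}^N u_i(x_i)-c(x_1,\dots,x_N)}{\varepsilon}}\,d\rho^N+\varepsilon\in[-\infty,+\infty).$$ $\Pi(\rho_1,\dots,\rho_N)$ is the set of Borel probability measures on $X_1\times\cdots\times X_N$ with $i$-th marginal $\rho_i$ for all $i$. For $\gamma\in\Pi(\rho_1,\dots,\rho_N)$, $\mathcal C^N_\varepsilon(\gamma)=\int c\,d\gamma+\varepsilon\mathcal H(\gamma|\rho^N)$, where $\mathcal H(\gamma|\rho^N)=\int h\log h\,d\rho^N$ if $\gamma\ll\rho^N$ with density $h$, and $+\infty$ otherwise. *)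

theory Defs
  imports "HOL-Probability.Probability"
begin

text \<open>
  The spaces X_1, ..., X_N are topologies \<open>X 1, ..., X N\<close> on subsets of one carrier type.
  This is no restriction: finitely many Polish spaces embed into the disjoint union of their
  underlying sets.  Their product is the library's \<open>product_topology X {1..N}\<close>, whose points
  are the functions that are \<open>undefined\<close> outside \<open>{1..N}\<close>, as in \<open>PiM {1..N} \<rho>\<close>.
\<close>

definition polish_topology :: "'a topology \<Rightarrow> bool" where
  "polish_topology X \<longleftrightarrow> completely_metrizable_space X \<and> separable_space X"

definition borel_of :: "'a topology \<Rightarrow> 'a measure" where
  "borel_of X = sigma (topspace X) {U. openin X U}"

definition borel_prob_on :: "'a topology \<Rightarrow> 'a measure \<Rightarrow> bool" where
  "borel_prob_on X \<mu> \<longleftrightarrow> sets \<mu> = sets (borel_of X) \<and> prob_space \<mu>"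

definition lower_semicontinuous_on :: "'a topology \<Rightarrow> ('a \<Rightarrow> ennreal) \<Rightarrow> bool" where
  "lower_semicontinuous_on X f \<longleftrightarrow> (\<forall>a. openin X {x \<in> topspace X. a < f x})"

definition transport_plans ::
    "nat \<Rightarrow> (nat \<Rightarrow> 'a topology) \<Rightarrow> (nat \<Rightarrow> 'a measure) \<Rightarrow> (nat \<Rightarrow> 'a) measure set" where
  "transport_plans N X \<rho> =
     {\<gamma>. borel_prob_on (product_topology X {1..N}) \<gamma> \<and>
         (\<forall>i\<in>{1..N}. distr \<gamma> (\<rho> i) (\<lambda>x. x i) = \<rho> i)}"

text \<open>
  \<open>gibbs_density\<close> is the density exp ((\<Sum>i. u_i(x_i) - c(x)) / \<epsilon>), with the convention
  that exp of minus infinity is 0 where the cost is infinite.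
\<close>

definition gibbs_density ::
    "nat \<Rightarrow> real \<Rightarrow> ((nat \<Rightarrow> 'a) \<Rightarrow> ennreal) \<Rightarrow> (nat \<Rightarrow> 'a \<Rightarrow> real) \<Rightarrow> (nat \<Rightarrow> 'a) \<Rightarrow> ennreal" where
  "gibbs_density N \<epsilon> c u x =
     (if c x = \<infinity> then 0
      else ennreal (exp (((\<Sum>i\<in>{1..N}. u i (x i)) - enn2real (c x)) / \<epsilon>)))"

definition L1_tuple :: "nat \<Rightarrow> (nat \<Rightarrow> 'a measure) \<Rightarrow> (nat \<Rightarrow> 'a \<Rightarrow> real) \<Rightarrow> bool" where
  "L1_tuple N \<rho> u \<longleftrightarrow> (\<forall>i\<in>{1..N}. integrable (\<rho> i) (u i))"

definition dual_functional ::
    "nat \<Rightarrow> (nat \<Rightarrow> 'a measure) \<Rightarrow> real \<Rightarrow> ((nat \<Rightarrow> 'a) \<Rightarrow> ennreal) \<Rightarrow> (nat \<Rightarrow> 'a \<Rightarrow> real) \<Rightarrow> ereal" where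
  "dual_functional N \<rho> \<epsilon> c u =
     ereal (\<Sum>i\<in>{1..N}. \<integral>x. u i x \<partial>\<rho> i)
     - ereal \<epsilon> * enn2ereal (\<integral>\<^sup>+x. gibbs_density N \<epsilon> c u x \<partial>PiM {1..N} \<rho>)
     + ereal \<epsilon>"

text \<open>
  The integral of h log h is positive part minus negative part, as an extended real; for finite
  \<open>\<mu>\<close> the negative part is finite because t log t \<ge> -1/e.  The library's \<open>KL_divergence\<close> is a
  Bochner integral, hence 0 instead of \<open>\<infinity>\<close> when h log h is not integrable.
\<close>

definition rel_entropy :: "'a measure \<Rightarrow> 'a measure \<Rightarrow> ereal" where
  "rel_entropy \<gamma> \<mu> =
     (if absolutely_continuous \<mu> \<gamma> then
        let h = (\<lambda>x. enn2real (RN_deriv \<mu> \<gamma> x)) in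
          enn2ereal (\<integral>\<^sup>+x. ennreal (h x * ln (h x)) \<partial>\<mu>)
          - enn2ereal (\<integral>\<^sup>+x. ennreal (- (h x * ln (h x))) \<partial>\<mu>)
      else \<infinity>)"

definition primal_functional ::
    "nat \<Rightarrow> (nat \<Rightarrow> 'a measure) \<Rightarrow> real \<Rightarrow> ((nat \<Rightarrow> 'a) \<Rightarrow> ennreal) \<Rightarrow> (nat \<Rightarrow> 'a) measure \<Rightarrow> ereal" where
  "primal_functional N \<rho> \<epsilon> c \<gamma> =
     enn2ereal (\<integral>\<^sup>+x. c x \<partial>\<gamma>) + ereal \<epsilon> * rel_entropy \<gamma> (PiM {1..N} \<rho>)"

end

(*
  Write T = (sum_i u_i(x_i) - c(x)) / eps.  Since c is integrable, maximizing the dual functional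
  means minimizing J(u) = integral of exp T - T, whose integrand dominates |T|.  The identity
    integral of (exp(T_u/2) - exp(T_v/2))^2 + 2 J((u+v)/2) = J(u) + J(v)
  makes exp(T_n/2) a Cauchy sequence in L^2 along any minimizing sequence, so along a fast one the
  sums sum_i u_i^n(x_i) converge almost everywhere, to finite values by Fatou's lemma for J.  Freezing
  all coordinates but one at a generic point shows that the limit is again a sum of one-variable
  functions; Fatou gives minimality, and |T| <= exp T - T together with Fubini gives integrability of
  each summand.  The same identity gives uniqueness.  Perturbing u_i by multiples of an indicator
  shows that exp T has marginals rho_i.  For a coupling with density h the primal cost equals
  sum_i integral of u_i plus eps times the integral of h ln h - h T - h + exp T, which is nonnegative
  and vanishes only for h = exp T.
*)

theory Submission
  imports Defs
begin

section \<open>Borel sets of product topologies\<close>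

text \<open>Balls of rational radius around the points of a countable dense set form a countable
  base.\<close>

lemma metrizable_separable_imp_second_countable:
  assumes "metrizable_space X" "separable_space X"
  shows "second_countable X"
proof -
  obtain M d where "Metric_space M d" and X: "X = Metric_space.mtopology M d"
    using assms(1) unfolding metrizable_space_def by blast
  interpret Metric_space M d by fact
  obtain C where C: "countable C" "C \<subseteq> M" "mtopology closure_of C = M"
    using assms(2) unfolding separable_space_def X by auto
  define B where "B = (\<lambda>(a, r). mball a r) ` (C \<times> (\<rat> \<inter> {0<..}))"
  have "\<exists>V\<in>B. x \<in> V \<and> V \<subseteq> U" if U: "openin mtopology U" "x \<in> U" for U x
  proof -
    have x: "x \<in> M" and "\<exists>r>0. mball x r \<subseteq> U"
      using U unfolding openin_mtopology by auto
    then obtain r where r: "r > 0" "mball x r \<subseteq> U" by blast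
    have "x \<in> mtopology closure_of C" using C x by simp
    then obtain a where a: "a \<in> C" "a \<in> mball x (r/4)"
      using r(1) unfolding metric_closure_of by (auto dest!: spec[of _ "r/4"])
    \<comment> \<open>A radius above \<open>r/4\<close> lets the ball around \<open>a\<close> reach
      \<open>x\<close>; a radius below \<open>r/2\<close> keeps it inside
      \<open>mball x r\<close>.\<close>
    obtain q where q: "q \<in> \<rat>" "r/4 < q" "q < r/2"
      using Rats_dense_in_real[of "r/4" "r/2"] r(1) by auto
    have aM: "a \<in> M" using a C by auto
    have "x \<in> mball a q"
      using a q x aM by (auto simp: in_mball commute)
    moreover have "mball a q \<subseteq> U"
    proof
      fix y assume "y \<in> mball a q"
      then have y: "y \<in> M" "d a y < q" by (auto simp: in_mball)
      have "d x y \<le> d x a + d a y" using triangle[OF x aM y(1)] .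
      also have "\<dots> < r" using a q y by (auto simp: in_mball)
      finally show "y \<in> U" using r(2) x y(1) by (auto simp: in_mball)
    qed
    moreover have "mball a q \<in> B" unfolding B_def using a q r(1) by force
    ultimately show ?thesis by blast
  qed
  moreover have "countable B"
    unfolding B_def using C(1) countable_rat by (intro countable_image countable_SIGMA) auto
  moreover have "\<forall>V\<in>B. openin mtopology V" unfolding B_def by auto
  ultimately show ?thesis unfolding second_countable_def X by blast
qed

lemma polish_imp_second_countable: "polish_topology X \<Longrightarrow> second_countable X"
  unfolding polish_topology_def
  by (simp add: completely_metrizable_imp_metrizable_space metrizable_separable_imp_second_countable)

lemma space_borel_of [simp]: "space (borel_of X) = topspace X"
  unfolding borel_of_def by (rule space_measure_of) (auto dest: openin_subset)

lemma sets_borel_of: "sets (borel_of X) = sigma_sets (topspace X) {U. openin X U}"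
  unfolding borel_of_def by (rule sets_measure_of) (auto dest: openin_subset)

lemma openin_imp_sets_borel_of: "openin X U \<Longrightarrow> U \<in> sets (borel_of X)"
  unfolding sets_borel_of by (rule sigma_sets.Basic) simp

text \<open>Second countability of the factors writes an open set of the product as a countable
  union of open boxes. This is what makes a lower semicontinuous cost measurable for the product
  measure, and it identifies Borel plans with measures on \<open>PiM\<close>.\<close>

lemma sets_borel_of_product_topology:
  assumes fin: "finite I" and sc: "\<And>i. i \<in> I \<Longrightarrow> second_countable (X i)"
  shows "sets (borel_of (product_topology X I)) = sets (PiM I (\<lambda>i. borel_of (X i)))"
proof
  show "sets (PiM I (\<lambda>i. borel_of (X i))) \<subseteq> sets (borel_of (product_topology X I))"
  proof (rule sets_PiM_in_sets)
    fix i A assume i: "i \<in> I" and A: "A \<in> sets (borel_of (X i))"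
    have "(\<lambda>x. x i) \<in> borel_of (product_topology X I) \<rightarrow>\<^sub>M borel_of (X i)"
      unfolding borel_of_def[of "X i"]
    proof (rule measurable_measure_of)
      fix U assume "U \<in> {U. openin (X i) U}"
      then have "openin (product_topology X I) {x \<in> topspace (product_topology X I). x i \<in> U}"
        by (intro openin_continuous_map_preimage[OF continuous_map_product_projection[OF i]]) auto
      moreover have "{x \<in> topspace (product_topology X I). x i \<in> U} =
          (\<lambda>x. x i) -` U \<inter> space (borel_of (product_topology X I))" by auto
      ultimately show "(\<lambda>x. x i) -` U \<inter> space (borel_of (product_topology X I))
          \<in> sets (borel_of (product_topology X I))"
        by (metis openin_imp_sets_borel_of)
    qed (use i in \<open>auto dest: openin_subset simp: PiE_iff\<close>)
    from measurable_sets[OF this A]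
    show "{x \<in> space (borel_of (product_topology X I)). x i \<in> A} \<in> sets (borel_of (product_topology X I))"
      by (simp add: vimage_def Int_def conj_commute)
  qed (auto simp: space_PiM)
next
  have "\<forall>i\<in>I. \<exists>B. countable B \<and> (\<forall>V\<in>B. openin (X i) V) \<and>
      (\<forall>U x. openin (X i) U \<and> x \<in> U \<longrightarrow> (\<exists>V\<in>B. x \<in> V \<and> V \<subseteq> U))"
    using sc unfolding second_countable_def by blast
  then obtain B where B: "\<And>i. i \<in> I \<Longrightarrow> countable (B i)"
      "\<And>i V. i \<in> I \<Longrightarrow> V \<in> B i \<Longrightarrow> openin (X i) V"
      "\<And>i U x. i \<in> I \<Longrightarrow> openin (X i) U \<Longrightarrow> x \<in> U \<Longrightarrow> \<exists>V\<in>B i. x \<in> V \<and> V \<subseteq> U"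
    by metis
  have "S \<in> sets (PiM I (\<lambda>i. borel_of (X i)))" if S: "openin (product_topology X I) S" for S
  proof -
    define F where "F = {V \<in> PiE I B. PiE I V \<subseteq> S}"
    have "countable F"
      unfolding F_def using countable_PiE[OF fin, of B] B(1) by (auto intro: countable_subset)
    moreover have "PiE I V \<in> sets (PiM I (\<lambda>i. borel_of (X i)))" if "V \<in> F" for V
      using that B(2) fin unfolding F_def
      by (intro sets_PiM_I_finite) (auto intro!: openin_imp_sets_borel_of simp: PiE_iff)
    moreover have "S = (\<Union>V\<in>F. PiE I V)"
    proof
      show "S \<subseteq> (\<Union>V\<in>F. PiE I V)"
      proof
        fix x assume "x \<in> S"
        then obtain U where U: "\<forall>i\<in>I. openin (X i) (U i)" "x \<in> PiE I U" "PiE I U \<subseteq> S"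
          using S unfolding openin_product_topology_alt by blast
        have "\<forall>i\<in>I. \<exists>V\<in>B i. x i \<in> V \<and> V \<subseteq> U i" using B(3) U by (auto simp: PiE_iff)
        then obtain V where V: "\<And>i. i \<in> I \<Longrightarrow> V i \<in> B i \<and> x i \<in> V i \<and> V i \<subseteq> U i" by metis
        \<comment> \<open>The choice of \<open>V\<close> constrains it only on \<open>I\<close>;
          restricting it gives an extensional family, as membership in \<open>PiE I B\<close>
          requires.\<close>
        have "PiE I (restrict V I) \<subseteq> PiE I U" using V by (intro PiE_mono) auto
        then have "restrict V I \<in> F" using V U(3) unfolding F_def by auto
        moreover have "x \<in> PiE I (restrict V I)" using V U(2) by (auto simp: PiE_iff)
        ultimately show "x \<in> (\<Union>V\<in>F. PiE I V)" by blast
      qed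
    qed (auto simp: F_def)
    ultimately show ?thesis by (metis (no_types, lifting) sets.countable_UN'')
  qed
  then show "sets (borel_of (product_topology X I)) \<subseteq> sets (PiM I (\<lambda>i. borel_of (X i)))"
    unfolding sets_borel_of
    using sets.sigma_sets_subset[of "{U. openin (product_topology X I) U}" "PiM I (\<lambda>i. borel_of (X i))"]
    by (auto simp: space_PiM)
qed

lemma lower_semicontinuous_on_borel_measurable:
  assumes "lower_semicontinuous_on X f"
  shows "f \<in> borel_measurable (borel_of X)"
  using assms unfolding lower_semicontinuous_on_def
  by (intro borel_measurableI_greater) (auto intro!: openin_imp_sets_borel_of)

section \<open>Sections of finite product measures\<close>

context product_prob_space
begin

lemma measurable_fun_upd_pair:
  "i \<in> I \<Longrightarrow> (\<lambda>(z, t). z(i := t)) \<in> PiM I M \<Otimes>\<^sub>M M i \<rightarrow>\<^sub>M PiM I M"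
  using measurable_add_dim[of i I M] by (simp add: insert_absorb)

text \<open>Resampling one coordinate independently preserves a product measure. In this form
  Fubini's theorem can freeze all coordinates but \<open>i\<close> without splitting the index
  set.\<close>

lemma distr_fun_upd:
  assumes "finite I" "i \<in> I"
  shows "distr (PiM I M \<Otimes>\<^sub>M M i) (PiM I M) (\<lambda>(z, t). z(i := t)) = PiM I M"
proof (rule PiM_eqI[OF assms(1)])
  interpret p: pair_sigma_finite "PiM I M" "M i" ..
  note meas = measurable_fun_upd_pair[OF assms(2)]
  fix A assume A: "\<And>j. j \<in> I \<Longrightarrow> A j \<in> sets (M j)"
  \<comment> \<open>The coordinate \<open>z i\<close> is overwritten, so the box condition on
    \<open>z\<close> leaves that side free; the free side has mass one.\<close>
  define B where "B = A(i := space (M i))"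
  have "(\<lambda>(z, t). z(i := t)) -` PiE I A \<inter> space (PiM I M \<Otimes>\<^sub>M M i) = PiE I B \<times> A i"
  proof (intro set_eqI iffI; clarsimp simp: space_pair_measure space_PiM)
    fix z t assume z: "z(i := t) \<in> PiE I A" "z \<in> (\<Pi>\<^sub>E j\<in>I. space (M j))"
    have "z j \<in> B j" if "j \<in> I" for j
      using z that PiE_mem[OF z(1) that] by (cases "j = i") (auto simp: B_def PiE_iff)
    then show "z \<in> PiE I B \<and> t \<in> A i"
      using z(2) PiE_mem[OF z(1) assms(2)] by (auto simp: PiE_iff)
  next
    fix z t assume z: "z \<in> PiE I B" "t \<in> A i"
    have "(z(i := t)) j \<in> A j \<and> z j \<in> space (M j)" if "j \<in> I" for j
      using z(2) PiE_mem[OF z(1) that] A[OF that, THEN sets.sets_into_space]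
      by (cases "j = i") (auto simp: B_def)
    moreover have "z(i := t) \<in> extensional I" using z(1) assms(2) by (auto simp: PiE_iff extensional_def)
    ultimately show "z(i := t) \<in> PiE I A \<and> z \<in> (\<Pi>\<^sub>E j\<in>I. space (M j)) \<and> t \<in> space (M i)"
      using z A[OF assms(2), THEN sets.sets_into_space] by (auto simp: PiE_iff)
  qed
  then have "emeasure (distr (PiM I M \<Otimes>\<^sub>M M i) (PiM I M) (\<lambda>(z, t). z(i := t))) (PiE I A) =
      emeasure (PiM I M \<Otimes>\<^sub>M M i) (PiE I B \<times> A i)"
    using A assms by (subst emeasure_distr[OF meas]) (auto intro!: sets_PiM_I_finite)
  also have "\<dots> = emeasure (PiM I M) (PiE I B) * emeasure (M i) (A i)"
    using A assms by (intro M.emeasure_pair_measure_Times sets_PiM_I_finite) (auto simp: B_def)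
  also have "emeasure (PiM I M) (PiE I B) = (\<Prod>j\<in>I. emeasure (M j) (B j))"
    using A assms by (intro emeasure_PiM) (auto simp: B_def)
  also have "\<dots> = (\<Prod>j\<in>I - {i}. emeasure (M j) (A j))"
    unfolding prod.remove[OF assms, of "\<lambda>j. emeasure (M j) (B j)"]
    by (simp add: B_def M.emeasure_space_1)
  also have "\<dots> * emeasure (M i) (A i) = (\<Prod>j\<in>I. emeasure (M j) (A j))"
    unfolding prod.remove[OF assms, of "\<lambda>j. emeasure (M j) (A j)"] by (rule mult.commute)
  finally show "emeasure (distr (PiM I M \<Otimes>\<^sub>M M i) (PiM I M) (\<lambda>(z, t). z(i := t))) (PiE I A) =
      (\<Prod>j\<in>I. emeasure (M j) (A j))" .
qed simp

text \<open>Almost every line in direction \<open>i\<close> through a generic point meets the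
  exceptional set in a null set. The base point \<open>z\<close> ranges over the full product, so
  one \<open>z\<close> can serve all directions at once.\<close>

lemma AE_PiM_section:
  assumes "finite I" "i \<in> I" "AE x in PiM I M. Q x"
  shows "AE z in PiM I M. AE t in M i. Q (z(i := t))"
proof -
  interpret p: pair_sigma_finite "PiM I M" "M i" ..
  have "AE x in distr (PiM I M \<Otimes>\<^sub>M M i) (PiM I M) (\<lambda>(z, t). z(i := t)). Q x"
    unfolding distr_fun_upd[OF assms(1,2)] by (rule assms(3))
  from p.AE_pair[OF AE_distrD[OF measurable_fun_upd_pair[OF assms(2)] this]]
  show ?thesis by simp
qed

lemma AE_integrable_PiM_section:
  fixes f :: "_ \<Rightarrow> real"
  assumes "finite I" "i \<in> I" "integrable (PiM I M) f"
  shows "AE z in PiM I M. integrable (M i) (\<lambda>t. f (z(i := t)))"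
proof -
  interpret p: pair_sigma_finite "PiM I M" "M i" ..
  have "integrable (distr (PiM I M \<Otimes>\<^sub>M M i) (PiM I M) (\<lambda>(z, t). z(i := t))) f"
    unfolding distr_fun_upd[OF assms(1,2)] by (rule assms(3))
  from p.AE_integrable_fst'[OF integrable_distr[OF measurable_fun_upd_pair[OF assms(2)] this]]
  show ?thesis by simp
qed

end

section \<open>Elementary inequalities and sequences\<close>

text \<open>Turns comparisons of dual values into reversed comparisons of \<open>excess\<close>,
  infinite values included.\<close>

lemma ereal_minus_mult_less_iff:
  assumes "e > 0"
  shows "ereal a - ereal e * enn2ereal x < ereal a - ereal e * enn2ereal y \<longleftrightarrow> y < x"
  using assms by (cases x; cases y) (auto simp: enn2ereal_ennreal ennreal_less_iff)

text \<open>For \<open>t \<ge> 0\<close>, squaring \<open>1 + t/2 \<le> exp (t/2)\<close> reduces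
  the claim to \<open>(1 - t/2)^2 \<ge> 0\<close>; for negative \<open>t\<close> only
  \<open>exp t \<ge> 0\<close> remains.\<close>

lemma abs_le_exp_minus: "\<bar>t\<bar> \<le> exp t - (t::real)"
proof (cases "t \<ge> 0")
  case True
  have "1 + t/2 \<le> exp (t/2)" by (rule exp_ge_add_one_self)
  then have "(1 + t/2)^2 \<le> exp (t/2)^2" using True by (intro power_mono) auto
  also have "exp (t/2)^2 = exp t" by (simp add: power2_eq_square flip: exp_add)
  finally show ?thesis
    using True sum_squares_ge_zero[of "1 - t/2" 0] by (simp add: power2_eq_square algebra_simps)
qed simp

text \<open>By the inequality of arithmetic and geometric means, an increment \<open>d\<close> is at
  most \<open>(1/2)^n + 2^n * d^2\<close>, so the increments are absolutely summable. This yields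
  pointwise convergence directly from bounds on squared distances in L^2.\<close>

lemma convergent_if_weighted_square_sum_finite:
  fixes w :: "nat \<Rightarrow> real"
  assumes "(\<Sum>n. ennreal (2^n * (w n - w (Suc n))\<^sup>2)) \<noteq> \<top>"
  shows "convergent w"
proof -
  have "summable (\<lambda>n. 2^n * (w n - w (Suc n))\<^sup>2)"
    using assms by (intro summable_suminf_not_top) auto
  then have "summable (\<lambda>n. (1/2)^n + 2^n * (w n - w (Suc n))\<^sup>2)"
    by (intro summable_add summable_geometric) auto
  moreover have "norm (w (Suc n) - w n) \<le> (1/2)^n + 2^n * (w n - w (Suc n))\<^sup>2" for n
  proof -
    define d where "d = \<bar>w n - w (Suc n)\<bar>"
    define p :: real where "p = 2^n"
    have p: "p > 0" by (simp add: p_def)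
    have "0 \<le> (p * d - 1)\<^sup>2 + p * d" using p by (simp add: d_def)
    then have "d * p \<le> 1 + p * d\<^sup>2 * p" by (simp add: power2_eq_square algebra_simps)
    then have "d \<le> 1/p + p * d\<^sup>2" using p by (simp add: field_simps)
    then show ?thesis by (simp add: d_def p_def power_one_over abs_minus_commute)
  qed
  ultimately have "summable (\<lambda>n. w (Suc n) - w n)"
    by (rule summable_comparison_test'[where N = 0])
  then have "convergent (\<lambda>n. (w n - w 0) + w 0)"
    unfolding summable_iff_convergent sum_lessThan_telescope
    by (intro convergent_add convergent_const)
  then show ?thesis by simp
qed

text \<open>Taking logarithms works unless the exponentials tend to zero. In that case
  \<open>s n\<close> would tend to minus infinity and \<open>exp (s n) - s n\<close> to infinity,
  against the finite lower limit.\<close>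

lemma convergent_exponent:
  fixes s :: "nat \<Rightarrow> real"
  assumes "convergent (\<lambda>n. exp (s n / 2))" and "liminf (\<lambda>n. ennreal (exp (s n) - s n)) < \<infinity>"
  shows "convergent s"
proof -
  obtain L where L: "(\<lambda>n. exp (s n / 2)) \<longlonglongrightarrow> L" using assms(1) by (auto simp: convergent_def)
  have "L \<ge> 0" by (rule LIMSEQ_le_const[OF L]) auto
  moreover have "L \<noteq> 0"
  proof
    assume "L = 0"
    \<comment> \<open>One more than the lower limit: once \<open>s n < - C\<close>, the terms are at
      least \<open>C\<close>, which the lower limit would have to reach.\<close>
    define C where "C = enn2real (liminf (\<lambda>n. ennreal (exp (s n) - s n))) + 1"
    have "\<forall>\<^sub>F n in sequentially. exp (s n / 2) < exp (- C / 2)"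
      using L unfolding \<open>L = 0\<close> by (rule order_tendstoD) simp
    then have "\<forall>\<^sub>F n in sequentially. ennreal C \<le> ennreal (exp (s n) - s n)"
    proof eventually_elim
      case (elim n)
      then show ?case using abs_le_exp_minus[of "s n"] by (intro ennreal_leI) (simp add: less_divide_eq)
    qed
    then have "ennreal C \<le> liminf (\<lambda>n. ennreal (exp (s n) - s n))" by (rule Liminf_bounded)
    also have "\<dots> = ennreal (C - 1)" unfolding C_def using assms(2) by simp
    finally show False by (simp add: C_def ennreal_le_iff)
  qed
  ultimately have "(\<lambda>n. 2 * ln (exp (s n / 2))) \<longlonglongrightarrow> 2 * ln L"
    by (intro tendsto_intros L) auto
  then show ?thesis by (auto simp: convergent_def)
qed

text \<open>The difference of the two sides is minimal at \<open>s = 0\<close>, where it vanishes,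
  so its derivative \<open>q - p\<close> there is zero. This is the first-order condition behind the
  marginals of the Gibbs plan.\<close>

lemma eq_if_mult_le_exp_minus_one:
  fixes p q :: real
  assumes "\<And>s. s * p \<le> (exp s - 1) * q"
  shows "p = q"
proof -
  have "((\<lambda>s. (exp s - 1) * q - s * p) has_field_derivative (q - p)) (at 0)"
    by (auto intro!: derivative_eq_intros)
  then have "q - p = 0"
    by (rule DERIV_local_min[where d = 1]) (use assms in auto)
  then show ?thesis by simp
qed

lemma mult_ln_ge:
  fixes h :: real
  assumes "h \<ge> 0"
  shows "h - 1 \<le> h * ln h"
proof (cases "h = 0")
  case False
  then have "h > 0" using assms by simp
  with ln_le_minus_one[of "1/h"] have "1 - 1/h \<le> ln h" by (simp add: ln_div)
  from mult_left_mono[OF this assms] show ?thesis using False by (simp add: algebra_simps)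
qed simp

text \<open>Fenchel-Young inequality for \<open>h ln h - h\<close> and its conjugate
  \<open>exp\<close>, with the equality case. For \<open>h > 0\<close>, factoring out
  \<open>h\<close> leaves \<open>exp s - s - 1\<close> at \<open>s = t - ln h\<close>; for
  \<open>h = 0\<close> the expression is \<open>exp t > 0\<close>.\<close>

lemma exp_ge_mult_ln:
  fixes h t :: real
  assumes "h \<ge> 0"
  shows "0 \<le> h * ln h - h * t - h + exp t"
    and "h * ln h - h * t - h + exp t = 0 \<Longrightarrow> h = exp t"
proof -
  have eq: "h * ln h - h * t - h + exp t = h * (exp (t - ln h) - (t - ln h) - 1)" if "h > 0"
    using that by (simp add: exp_diff algebra_simps)
  show "0 \<le> h * ln h - h * t - h + exp t"
  proof (cases "h = 0")
    case False
    then show ?thesis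
      using assms exp_ge_add_one_self[of "t - ln h"]
      by (subst eq) (auto intro!: mult_nonneg_nonneg simp del: exp_ge_add_one_self)
  qed simp
  assume 0: "h * ln h - h * t - h + exp t = 0"
  then have "h > 0" using assms by (cases "h = 0") auto
  with 0 eq have "exp (t - ln h) - 1 = t - ln h" by simp
  then have "ln (exp (t - ln h)) = exp (t - ln h) - 1" by simp
  from ln_eq_minus_one[OF _ this] have "t = ln h" by simp
  with \<open>h > 0\<close> show "h = exp t" by simp
qed

section \<open>The dual problem\<close>

text \<open>The purely measure-theoretic setting. Topology enters through measurability of the cost,
  and the bound on the partial integrals enters through \<open>cost_finite\<close>.\<close>

locale entropic_transport = product_prob_space \<rho> "{1..N}"
  for N :: nat and \<rho> :: "nat \<Rightarrow> 'a measure" +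
  fixes \<epsilon> :: real and c :: "(nat \<Rightarrow> 'a) \<Rightarrow> ennreal"
  assumes N_pos: "N \<ge> 1" and eps_pos: "\<epsilon> > 0"
    and cost_measurable [measurable]: "c \<in> borel_measurable (PiM {1..N} \<rho>)"
    and cost_finite: "(\<integral>\<^sup>+x. c x \<partial>PiM {1..N} \<rho>) < \<infinity>"
begin

declare One_nat_def [simp del]

abbreviation "\<mu> \<equiv> PiM {1..N} \<rho>"

definition potential_sum :: "(nat \<Rightarrow> 'a \<Rightarrow> real) \<Rightarrow> (nat \<Rightarrow> 'a) \<Rightarrow> real" where
  "potential_sum u x = (\<Sum>i\<in>{1..N}. u i (x i))"

text \<open>Where the cost is infinite, \<open>enn2real\<close> replaces it by zero and
  \<open>exp\<close> of this value differs from \<open>gibbs_density\<close>. Those points form a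
  null set, by \<open>AE_cost_finite\<close>.\<close>

definition exponent :: "(nat \<Rightarrow> 'a \<Rightarrow> real) \<Rightarrow> (nat \<Rightarrow> 'a) \<Rightarrow> real" where
  "exponent u x = (potential_sum u x - enn2real (c x)) / \<epsilon>"

text \<open>On integrable tuples the dual functional is a constant minus \<open>\<epsilon>\<close>
  times this quantity. The integrand is nonnegative, so the integral makes sense for every
  measurable tuple and Fatou's lemma applies to it.\<close>

definition excess :: "(nat \<Rightarrow> 'a \<Rightarrow> real) \<Rightarrow> ennreal" where
  "excess u = (\<integral>\<^sup>+x. ennreal (exp (exponent u x) - exponent u x) \<partial>\<mu>)"

definition measurable_tuple :: "(nat \<Rightarrow> 'a \<Rightarrow> real) \<Rightarrow> bool" where
  "measurable_tuple u \<longleftrightarrow> (\<forall>i\<in>{1..N}. u i \<in> borel_measurable (\<rho> i))"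

lemma L1_imp_measurable_tuple: "L1_tuple N \<rho> u \<Longrightarrow> measurable_tuple u"
  by (auto simp: L1_tuple_def measurable_tuple_def)

lemma potential_sum_measurable [measurable]:
  assumes "measurable_tuple u"
  shows "potential_sum u \<in> borel_measurable \<mu>"
  unfolding potential_sum_def using assms
  by (intro borel_measurable_sum measurable_compose[OF measurable_component_singleton])
     (auto simp: measurable_tuple_def)

lemma exponent_measurable [measurable]:
  assumes "measurable_tuple u"
  shows "exponent u \<in> borel_measurable \<mu>"
  unfolding exponent_def using assms by measurable

lemma exponent_exp_minus_nonneg: "0 \<le> exp (exponent u x) - exponent u x"
  using abs_le_exp_minus[of "exponent u x"] by linarith

lemma AE_cost_finite: "AE x in \<mu>. c x \<noteq> \<infinity>"
  using nn_integral_PInf_AE[OF cost_measurable] cost_finite by simp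

lemma integrable_cost: "integrable \<mu> (\<lambda>x. enn2real (c x))"
proof (rule integrableI_bounded)
  have "(\<integral>\<^sup>+x. ennreal (norm (enn2real (c x))) \<partial>\<mu>) \<le> (\<integral>\<^sup>+x. c x \<partial>\<mu>)"
    by (intro nn_integral_mono) (metis abs_of_nonneg enn2real_nonneg ennreal_enn2real_if real_norm_def order_refl zero_le)
  then show "(\<integral>\<^sup>+x. ennreal (norm (enn2real (c x))) \<partial>\<mu>) < \<infinity>"
    using cost_finite by (simp add: order_le_less_trans)
qed measurable

lemma gibbs_density_eq: "c x \<noteq> \<infinity> \<Longrightarrow> gibbs_density N \<epsilon> c u x = ennreal (exp (exponent u x))"
  by (simp add: gibbs_density_def exponent_def potential_sum_def)

lemma AE_gibbs_density_eq: "AE x in \<mu>. gibbs_density N \<epsilon> c u x = ennreal (exp (exponent u x))"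
  using AE_cost_finite by eventually_elim (rule gibbs_density_eq)

lemma gibbs_density_measurable [measurable]:
  assumes [measurable]: "measurable_tuple u"
  shows "gibbs_density N \<epsilon> c u \<in> borel_measurable \<mu>"
proof -
  have "gibbs_density N \<epsilon> c u = (\<lambda>x. if c x = \<infinity> then 0 else ennreal (exp (exponent u x)))"
    by (auto simp: fun_eq_iff gibbs_density_def exponent_def potential_sum_def)
  then show ?thesis by simp
qed

section \<open>Integration of potentials against plans, and the dual functional in terms of
  \<open>excess\<close>\<close>

lemma integral_potential_sum:
  assumes \<gamma>: "sets \<gamma> = sets \<mu>" and marg: "\<And>i. i \<in> {1..N} \<Longrightarrow> distr \<gamma> (\<rho> i) (\<lambda>x. x i) = \<rho> i"
    and u: "L1_tuple N \<rho> u"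
  shows "integrable \<gamma> (potential_sum u)"
    and "(\<integral>x. potential_sum u x \<partial>\<gamma>) = (\<Sum>i\<in>{1..N}. \<integral>x. u i x \<partial>\<rho> i)"
proof -
  have *: "integrable \<gamma> (\<lambda>x. u i (x i))" "(\<integral>x. u i (x i) \<partial>\<gamma>) = (\<integral>x. u i x \<partial>\<rho> i)"
    if i: "i \<in> {1..N}" for i
  proof -
    have m: "(\<lambda>x. x i) \<in> \<gamma> \<rightarrow>\<^sub>M \<rho> i"
      unfolding measurable_cong_sets[OF \<gamma> refl] using i by (rule measurable_component_singleton)
    have int: "integrable (\<rho> i) (u i)" using u i by (auto simp: L1_tuple_def)
    then have int': "integrable (distr \<gamma> (\<rho> i) (\<lambda>x. x i)) (u i)" by (subst marg[OF i])
    from integrable_distr[OF m int'] show "integrable \<gamma> (\<lambda>x. u i (x i))" .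
    from integral_distr[OF m borel_measurable_integrable[OF int]]
    show "(\<integral>x. u i (x i) \<partial>\<gamma>) = (\<integral>x. u i x \<partial>\<rho> i)" by (simp add: marg[OF i])
  qed
  show "integrable \<gamma> (potential_sum u)"
    unfolding potential_sum_def using * by (intro Bochner_Integration.integrable_sum) auto
  show "(\<integral>x. potential_sum u x \<partial>\<gamma>) = (\<Sum>i\<in>{1..N}. \<integral>x. u i x \<partial>\<rho> i)"
    unfolding potential_sum_def using * by (subst Bochner_Integration.integral_sum) auto
qed

lemma integral_exponent:
  assumes "L1_tuple N \<rho> u"
  shows "integrable \<mu> (exponent u)"
    and "(\<integral>x. exponent u x \<partial>\<mu>) =
      ((\<Sum>i\<in>{1..N}. \<integral>x. u i x \<partial>\<rho> i) - (\<integral>x. enn2real (c x) \<partial>\<mu>)) / \<epsilon>"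
  using integral_potential_sum[OF refl PiM_component assms] integrable_cost
  by (auto simp: exponent_def[abs_def])

text \<open>The integral of \<open>exponent u\<close> is finite and can be added and subtracted. If
  \<open>exp (exponent u)\<close> is not integrable, then \<open>excess u\<close> is infinite as
  well and both sides are minus infinity.\<close>

lemma dual_functional_eq_excess:
  assumes u: "L1_tuple N \<rho> u"
  shows "dual_functional N \<rho> \<epsilon> c u =
    ereal (\<epsilon> + (\<integral>x. enn2real (c x) \<partial>\<mu>)) - ereal \<epsilon> * enn2ereal (excess u)"
proof -
  note [measurable] = L1_imp_measurable_tuple[OF u]
  note T = integral_exponent[OF u]
  have E: "(\<integral>\<^sup>+x. gibbs_density N \<epsilon> c u x \<partial>\<mu>) = (\<integral>\<^sup>+x. ennreal (exp (exponent u x)) \<partial>\<mu>)"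
    using AE_gibbs_density_eq by (rule nn_integral_cong_AE)
  show ?thesis
  proof (cases "integrable \<mu> (\<lambda>x. exp (exponent u x))")
    case True
    have "(\<integral>\<^sup>+x. ennreal (exp (exponent u x)) \<partial>\<mu>) = ennreal (\<integral>x. exp (exponent u x) \<partial>\<mu>)"
      using True by (intro nn_integral_eq_integral) auto
    moreover have "excess u = ennreal (\<integral>x. exp (exponent u x) - exponent u x \<partial>\<mu>)"
      unfolding excess_def using True T(1) exponent_exp_minus_nonneg
      by (intro nn_integral_eq_integral) auto
    moreover have "0 \<le> (\<integral>x. exp (exponent u x) - exponent u x \<partial>\<mu>)"
      using exponent_exp_minus_nonneg by (intro Bochner_Integration.integral_nonneg) auto
    moreover have "(\<integral>x. exp (exponent u x) - exponent u x \<partial>\<mu>) =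
        (\<integral>x. exp (exponent u x) \<partial>\<mu>) - (\<integral>x. exponent u x \<partial>\<mu>)"
      using True T(1) by simp
    ultimately show ?thesis
      unfolding dual_functional_def E using eps_pos
      by (simp add: enn2ereal_ennreal T(2) field_simps)
  next
    case False
    have "excess u = \<infinity>"
    proof (rule ccontr)
      assume "excess u \<noteq> \<infinity>"
      then have "integrable \<mu> (\<lambda>x. exp (exponent u x) - exponent u x)"
        using exponent_exp_minus_nonneg unfolding excess_def
        by (intro integrableI_nonneg) (auto simp: top.not_eq_extremum)
      from Bochner_Integration.integrable_add[OF this T(1)] False show False by simp
    qed
    moreover have "(\<integral>\<^sup>+x. ennreal (exp (exponent u x)) \<partial>\<mu>) = \<infinity>"
    proof (rule ccontr)
      assume "(\<integral>\<^sup>+x. ennreal (exp (exponent u x)) \<partial>\<mu>) \<noteq> \<infinity>"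
      then have "integrable \<mu> (\<lambda>x. exp (exponent u x))"
        by (intro integrableI_nonneg) (auto simp: top.not_eq_extremum)
      with False show False by simp
    qed
    ultimately show ?thesis unfolding dual_functional_def E using eps_pos by simp
  qed
qed

lemma is_arg_max_dual_iff:
  "is_arg_max (dual_functional N \<rho> \<epsilon> c) (L1_tuple N \<rho>) u \<longleftrightarrow>
    L1_tuple N \<rho> u \<and> (\<forall>v. L1_tuple N \<rho> v \<longrightarrow> excess u \<le> excess v)"
  unfolding is_arg_max_def
  by (metis dual_functional_eq_excess ereal_minus_mult_less_iff[OF eps_pos] not_less)

text \<open>The exponent is affine in the tuple, so its value at the midpoint is the mean of the two
  exponents. Pointwise the identity is then the expansion of a square in which the linear terms
  cancel. The additive form covers infinite values of \<open>excess\<close> too.\<close>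

lemma excess_parallelogram:
  assumes [measurable]: "measurable_tuple u" "measurable_tuple v"
  shows "(\<integral>\<^sup>+x. ennreal ((exp (exponent u x / 2) - exp (exponent v x / 2))\<^sup>2) \<partial>\<mu>)
      + 2 * excess (\<lambda>i t. (u i t + v i t) / 2) = excess u + excess v"
proof -
  define w where "w = (\<lambda>i t. (u i t + v i t) / 2)"
  have [measurable]: "measurable_tuple w"
    using assms unfolding measurable_tuple_def w_def
    by (auto intro!: borel_measurable_divide borel_measurable_add)
  have w: "exponent w x = (exponent u x + exponent v x) / 2" for x
    by (simp add: exponent_def potential_sum_def w_def sum.distrib flip: sum_divide_distrib add_divide_distrib)
       (simp add: field_simps)
  have *: "(exp (a/2) - exp (b/2))\<^sup>2 + 2 * (exp ((a+b)/2) - (a+b)/2) = (exp a - a) + (exp b - b)"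
    for a b :: real
    by (simp add: power2_eq_square algebra_simps add_divide_distrib flip: exp_add)
  have "(\<integral>\<^sup>+x. ennreal ((exp (exponent u x / 2) - exp (exponent v x / 2))\<^sup>2) \<partial>\<mu>) + 2 * excess w =
      (\<integral>\<^sup>+x. ennreal ((exp (exponent u x / 2) - exp (exponent v x / 2))\<^sup>2)
        + 2 * ennreal (exp (exponent w x) - exponent w x) \<partial>\<mu>)"
    unfolding excess_def by (simp add: nn_integral_add nn_integral_cmult)
  also have "\<dots> = (\<integral>\<^sup>+x. ennreal (exp (exponent u x) - exponent u x)
        + ennreal (exp (exponent v x) - exponent v x) \<partial>\<mu>)"
  proof (intro nn_integral_cong)
    fix x
    have "2 * ennreal (exp (exponent w x) - exponent w x) = ennreal (2 * (exp (exponent w x) - exponent w x))"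
      using exponent_exp_minus_nonneg[of w x] by (subst ennreal_mult) auto
    then show "ennreal ((exp (exponent u x / 2) - exp (exponent v x / 2))\<^sup>2)
        + 2 * ennreal (exp (exponent w x) - exponent w x) =
      ennreal (exp (exponent u x) - exponent u x) + ennreal (exp (exponent v x) - exponent v x)"
      using exponent_exp_minus_nonneg[of u x] exponent_exp_minus_nonneg[of v x]
        exponent_exp_minus_nonneg[of w x] *[of "exponent u x" "exponent v x"]
      by (simp add: w flip: ennreal_plus)
  qed
  also have "\<dots> = excess u + excess v"
    unfolding excess_def by (simp add: nn_integral_add)
  finally show ?thesis unfolding w_def .
qed

text \<open>The zero tuple is the competitor that makes the infimum finite: its exponent is
  nonpositive, so the exponential is at most one and the rest is the integrable cost.\<close>

lemma excess_zero_finite: "excess (\<lambda>i t. 0) < \<infinity>"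
proof -
  have eq: "exponent (\<lambda>i t. 0) x = - enn2real (c x) / \<epsilon>" for x
    by (simp add: exponent_def potential_sum_def)
  have "excess (\<lambda>i t. 0) \<le> (\<integral>\<^sup>+x. ennreal (1 + enn2real (c x) / \<epsilon>) \<partial>\<mu>)"
    unfolding excess_def eq using eps_pos by (intro nn_integral_mono ennreal_leI) simp
  also have "\<dots> = ennreal (\<integral>x. 1 + enn2real (c x) / \<epsilon> \<partial>\<mu>)"
    using eps_pos integrable_cost by (intro nn_integral_eq_integral) auto
  finally show ?thesis by (simp add: order_le_less_trans)
qed

section \<open>Generic points and sums of one-variable functions\<close>

lemma PiM_AE_happens:
  assumes "AE x in \<mu>. Q x"
  obtains x where "x \<in> space \<mu>" "Q x"
proof -
  have "AE x in \<mu>. x \<in> space \<mu> \<and> Q x" using assms AE_space by eventually_elim auto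
  from eventually_happens'[OF P.ae_filter_bot this] show ?thesis using that by blast
qed

lemma AE_PiM_sections:
  assumes "AE x in \<mu>. Q x"
  shows "AE z in \<mu>. \<forall>i\<in>{1..N}. AE t in \<rho> i. Q (z(i := t))"
  using AE_PiM_section[OF _ _ assms] by (subst AE_ball_countable) auto

lemma AE_components:
  assumes "\<And>i. i \<in> {1..N} \<Longrightarrow> AE t in \<rho> i. Q i t"
  shows "AE x in \<mu>. \<forall>i\<in>{1..N}. Q i (x i)"
proof (subst AE_ball_countable)
  show "\<forall>i\<in>{1..N}. AE x in \<mu>. Q i (x i)"
    using AE_PiM_component[where M = \<rho>, OF prob_space _ assms] by blast
qed auto

lemma potential_sum_fun_upd:
  assumes "i \<in> {1..N}"
  shows "potential_sum u (z(i := t)) = potential_sum u z - u i (z i) + u i t"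
proof -
  have "(\<Sum>j\<in>{1..N} - {i}. u j ((z(i := t)) j)) = (\<Sum>j\<in>{1..N} - {i}. u j (z j))"
    by (rule sum.cong) auto
  then show ?thesis
    unfolding potential_sum_def using assms by (simp add: sum.remove[of _ i])
qed

text \<open>At a generic \<open>z\<close> the sums agree at \<open>z\<close> and along almost all of
  each coordinate line through \<open>z\<close>. Subtracting the two equations isolates coordinate
  \<open>i\<close>, where the difference is the constant \<open>v i (z i) - u i (z i)\<close>; these
  constants add up to zero by equality at \<open>z\<close>.\<close>

lemma potential_sum_AE_eq_iff:
  "(AE x in \<mu>. potential_sum u x = potential_sum v x) \<longleftrightarrow>
    (\<exists>a. (\<Sum>i\<in>{1..N}. a i) = 0 \<and> (\<forall>i\<in>{1..N}. AE t in \<rho> i. v i t = u i t + a i))"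
proof
  assume eq: "AE x in \<mu>. potential_sum u x = potential_sum v x"
  obtain z where z: "potential_sum u z = potential_sum v z"
    "\<forall>i\<in>{1..N}. AE t in \<rho> i. potential_sum u (z(i := t)) = potential_sum v (z(i := t))"
    using PiM_AE_happens[OF AE_conjI[OF eq AE_PiM_sections[OF eq]]] by blast
  define a where "a i = v i (z i) - u i (z i)" for i
  have "(\<Sum>i\<in>{1..N}. a i) = 0"
    using z(1) by (simp add: a_def potential_sum_def sum_subtractf)
  moreover have "AE t in \<rho> i. v i t = u i t + a i" if "i \<in> {1..N}" for i
    using bspec[OF z(2) that]
    by eventually_elim (use z(1) in \<open>simp add: potential_sum_fun_upd[OF that] a_def\<close>)
  ultimately show "\<exists>a. (\<Sum>i\<in>{1..N}. a i) = 0 \<and> (\<forall>i\<in>{1..N}. AE t in \<rho> i. v i t = u i t + a i)"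
    by blast
next
  assume "\<exists>a. (\<Sum>i\<in>{1..N}. a i) = 0 \<and> (\<forall>i\<in>{1..N}. AE t in \<rho> i. v i t = u i t + a i)"
  then obtain a where a: "(\<Sum>i\<in>{1..N}. a i) = 0"
    "\<And>i. i \<in> {1..N} \<Longrightarrow> AE t in \<rho> i. v i t = u i t + a i" by blast
  have "AE x in \<mu>. \<forall>i\<in>{1..N}. v i (x i) = u i (x i) + a i"
    using AE_components[where Q = "\<lambda>i t. v i t = u i t + a i"] a(2) by blast
  then
  show "AE x in \<mu>. potential_sum u x = potential_sum v x"
  proof eventually_elim
    case (elim x)
    then have "potential_sum v x = (\<Sum>i\<in>{1..N}. u i (x i) + a i)"
      unfolding potential_sum_def by (intro sum.cong) auto
    then show ?case by (simp add: sum.distrib a(1) potential_sum_def)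
  qed
qed

text \<open>The separate functions \<open>u n i\<close> may diverge, because constants can move
  between coordinates. Anchoring at a generic \<open>z\<close> removes this freedom:
  \<open>f n i t\<close> is the sum at \<open>z(i := t)\<close> and converges for almost every
  \<open>t\<close>.\<close>

lemma potential_sum_limit:
  assumes meas: "\<And>n. measurable_tuple (u n)"
    and conv: "AE x in \<mu>. convergent (\<lambda>n. potential_sum (u n) x)"
  obtains v where "measurable_tuple v"
    "AE x in \<mu>. (\<lambda>n. potential_sum (u n) x) \<longlonglongrightarrow> potential_sum v x"
proof -
  obtain z where z: "convergent (\<lambda>n. potential_sum (u n) z)"
    "\<forall>i\<in>{1..N}. AE t in \<rho> i. convergent (\<lambda>n. potential_sum (u n) (z(i := t)))"
    using PiM_AE_happens[OF AE_conjI[OF conv AE_PiM_sections[OF conv]]] by blast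
  define f where "f n i t = potential_sum (u n) z - u n i (z i) + u n i t" for n i t
  define b where "b = Lim sequentially (\<lambda>n. potential_sum (u n) z)"
  \<comment> \<open>The sums at \<open>z(1 := x 1), \<dots>, z(N := x N)\<close> add up to the sum at \<open>x\<close> plus
    \<open>N - 1\<close> times the sum at \<open>z\<close>.\<close>
  define v where "v i t = Lim sequentially (\<lambda>n. f n i t) - (1 - 1 / real N) * b" for i t
  have b: "(\<lambda>n. potential_sum (u n) z) \<longlonglongrightarrow> b"
    using z(1) unfolding b_def convergent_LIMSEQ_iff .
  have "(\<lambda>t. f n i t) \<in> borel_measurable (\<rho> i)" if "i \<in> {1..N}" for n i
  proof -
    have [measurable]: "u n i \<in> borel_measurable (\<rho> i)"
      using meas that unfolding measurable_tuple_def by blast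
    show ?thesis unfolding f_def by measurable
  qed
  then have "measurable_tuple v"
    unfolding measurable_tuple_def v_def[abs_def]
    by (intro ballI borel_measurable_diff borel_measurable_lim_metric borel_measurable_const) auto
  moreover have "AE x in \<mu>. \<forall>i\<in>{1..N}. convergent (\<lambda>n. f n i (x i))"
  proof (rule AE_components)
    fix i assume i: "i \<in> {1..N}"
    show "AE t in \<rho> i. convergent (\<lambda>n. f n i t)"
      using z(2)[rule_format, OF i] by eventually_elim (simp add: potential_sum_fun_upd[OF i] f_def)
  qed
  then have "AE x in \<mu>. (\<lambda>n. potential_sum (u n) x) \<longlonglongrightarrow> potential_sum v x"
  proof eventually_elim
    case (elim x)
    have "(\<Sum>i\<in>{1..N}. f n i (x i)) - (real N - 1) * potential_sum (u n) z = potential_sum (u n) x" for n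
      by (simp add: f_def sum.distrib sum_subtractf potential_sum_def algebra_simps)
    moreover have "(\<lambda>n. (\<Sum>i\<in>{1..N}. f n i (x i)) - (real N - 1) * potential_sum (u n) z)
        \<longlonglongrightarrow> (\<Sum>i\<in>{1..N}. Lim sequentially (\<lambda>n. f n i (x i))) - (real N - 1) * b"
      using elim by (intro tendsto_intros b) (auto simp: convergent_LIMSEQ_iff)
    moreover have "(\<Sum>i\<in>{1..N}. Lim sequentially (\<lambda>n. f n i (x i))) - (real N - 1) * b = potential_sum v x"
    proof -
      \<comment> \<open>The total correction \<open>(N - 1) * b\<close> was shared equally among the
        \<open>N\<close> summands of \<open>v\<close>.\<close>
      have "(\<Sum>i\<in>{1..N}. (1 - 1 / real N) * b) = (real N - 1) * b"
        using N_pos by (simp add: field_simps)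
      then show ?thesis
        by (simp add: v_def potential_sum_def sum_subtractf del: sum_constant)
    qed
    ultimately show ?case by simp
  qed
  ultimately show thesis using that by blast
qed

text \<open>By \<open>abs_le_exp_minus\<close> the exponent is integrable, and with it the potential
  sum. Along a generic line in direction \<open>i\<close> that sum is \<open>v i\<close> plus a
  constant.\<close>

lemma finite_excess_imp_L1:
  assumes v: "measurable_tuple v" and fin: "excess v < \<infinity>"
  shows "L1_tuple N \<rho> v"
proof -
  note [measurable] = v
  have "integrable \<mu> (\<lambda>x. exp (exponent v x) - exponent v x)"
    using exponent_exp_minus_nonneg fin unfolding excess_def by (intro integrableI_nonneg) auto
  then have "integrable \<mu> (exponent v)"
  proof (rule Bochner_Integration.integrable_bound)
    show "AE x in \<mu>. norm (exponent v x) \<le> norm (exp (exponent v x) - exponent v x)"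
      by (rule AE_I2) (use abs_le_exp_minus exponent_exp_minus_nonneg in auto)
  qed measurable
  then have "integrable \<mu> (\<lambda>x. \<epsilon> * exponent v x + enn2real (c x))"
    using integrable_cost by auto
  moreover have "\<epsilon> * exponent v x + enn2real (c x) = potential_sum v x" for x
    using eps_pos by (simp add: exponent_def)
  ultimately have int: "integrable \<mu> (potential_sum v)" by simp
  show ?thesis
    unfolding L1_tuple_def
  proof
    fix i assume i: "i \<in> {1..N}"
    obtain z where "integrable (\<rho> i) (\<lambda>t. potential_sum v (z(i := t)))"
      by (rule PiM_AE_happens[OF AE_integrable_PiM_section[OF _ i int]]) auto
    then have "integrable (\<rho> i) (\<lambda>t. (potential_sum v (z(i := t))) - (potential_sum v z - v i (z i)))"
      by simp
    then show "integrable (\<rho> i) (v i)" by (simp add: potential_sum_fun_upd[OF i])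
  qed
qed

text \<open>The midpoint has excess at least \<open>m\<close>, so the parallelogram identity leaves
  at most \<open>d\<close> for the squared distance. A geometric \<open>d\<close> gives existence,
  and \<open>d = 0\<close> gives uniqueness.\<close>

lemma excess_midpoint_bound:
  assumes u: "L1_tuple N \<rho> u" and v: "L1_tuple N \<rho> v"
    and lower: "\<And>w. L1_tuple N \<rho> w \<Longrightarrow> m \<le> excess w" and m: "m < \<infinity>"
    and upper: "excess u + excess v \<le> 2 * m + d"
  shows "(\<integral>\<^sup>+x. ennreal ((exp (exponent u x / 2) - exp (exponent v x / 2))\<^sup>2) \<partial>\<mu>) \<le> d"
proof -
  have "L1_tuple N \<rho> (\<lambda>i t. (u i t + v i t) / 2)" using u v by (auto simp: L1_tuple_def)
  from mult_left_mono[OF lower[OF this], of 2]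
  have "2 * m \<le> 2 * excess (\<lambda>i t. (u i t + v i t) / 2)" by simp
  from add_left_mono[OF this] upper
  have "2 * m + (\<integral>\<^sup>+x. ennreal ((exp (exponent u x / 2) - exp (exponent v x / 2))\<^sup>2) \<partial>\<mu>) \<le> 2 * m + d"
    unfolding excess_parallelogram[OF L1_imp_measurable_tuple[OF u] L1_imp_measurable_tuple[OF v], symmetric]
      add.commute[of "2 * m" "nn_integral _ _"]
    by (rule order_trans)
  \<comment> \<open>Cancellation of \<open>2 * m\<close> in \<open>ennreal\<close> requires it to be
    finite.\<close>
  moreover have "2 * m \<noteq> \<top>" using m by (simp add: ennreal_mult_eq_top_iff)
  ultimately show ?thesis unfolding ennreal_add_left_cancel_le infinity_ennreal_def by blast
qed

section \<open>Existence of a minimizer of \<open>excess\<close>, hence of a dual maximizer\<close>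

lemma excess_minimizer_exists:
  "\<exists>v. L1_tuple N \<rho> v \<and> (\<forall>w. L1_tuple N \<rho> w \<longrightarrow> excess v \<le> excess w)"
proof -
  define m where "m = (INF u\<in>{u. L1_tuple N \<rho> u}. excess u)"
  have lower: "m \<le> excess w" if "L1_tuple N \<rho> w" for w
    unfolding m_def using that by (intro INF_lower) simp
  have "L1_tuple N \<rho> (\<lambda>i t. 0)" by (simp add: L1_tuple_def)
  then have m: "m < \<infinity>" using lower excess_zero_finite by (metis order_le_less_trans)
  \<comment> \<open>The rate \<open>(1/4)^n\<close> beats the weight \<open>2^n\<close> on the
    squared increments and leaves a geometric series.\<close>
  have "\<exists>u. L1_tuple N \<rho> u \<and> excess u < m + ennreal ((1/4)^n)" for n :: nat
  proof -
    have "m < m + ennreal ((1/4)^n)" using m by (cases m) (auto simp: ennreal_less_iff simp flip: ennreal_plus)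
    then show ?thesis unfolding m_def INF_less_iff by auto
  qed
  then obtain u where u: "\<And>n. L1_tuple N \<rho> (u n)" "\<And>n. excess (u n) < m + ennreal ((1/4)^n)"
    by metis
  note meas = L1_imp_measurable_tuple[OF u(1)]
  note [measurable] = meas
  define w where "w n x = exp (exponent (u n) x / 2)" for n x
  have [measurable]: "w n \<in> borel_measurable \<mu>" for n unfolding w_def by measurable
  have "(\<integral>\<^sup>+x. (\<Sum>n. ennreal (2^n * (w n x - w (Suc n) x)\<^sup>2)) \<partial>\<mu>)
      = (\<Sum>n. \<integral>\<^sup>+x. ennreal (2^n * (w n x - w (Suc n) x)\<^sup>2) \<partial>\<mu>)"
    by (rule nn_integral_suminf) measurable
  also have "\<dots> \<le> (\<Sum>n. ennreal (2 * (1/2)^n))"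
  proof (rule suminf_le)
    fix n
    have "excess (u n) + excess (u (Suc n)) \<le> (m + ennreal ((1/4)^n)) + (m + ennreal ((1/4)^Suc n))"
      using u(2) by (intro add_mono less_imp_le)
    also have "\<dots> = 2 * m + (ennreal ((1/4)^n) + ennreal ((1/4)^Suc n))"
      by (simp add: mult_2 add_ac)
    also have "\<dots> \<le> 2 * m + ennreal (2 * (1/4)^n)"
      by (intro add_left_mono) (simp add: ennreal_leI flip: ennreal_plus)
    finally have *: "(\<integral>\<^sup>+x. ennreal ((w n x - w (Suc n) x)\<^sup>2) \<partial>\<mu>) \<le> ennreal (2 * (1/4)^n)"
      unfolding w_def by (intro excess_midpoint_bound[OF u(1) u(1) lower m])
    have "(\<integral>\<^sup>+x. ennreal (2^n * (w n x - w (Suc n) x)\<^sup>2) \<partial>\<mu>)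
        = ennreal (2^n) * (\<integral>\<^sup>+x. ennreal ((w n x - w (Suc n) x)\<^sup>2) \<partial>\<mu>)"
      by (subst nn_integral_cmult[symmetric]) (auto simp: ennreal_mult)
    also have "\<dots> \<le> ennreal (2^n) * ennreal (2 * (1/4)^n)" using * by (rule mult_left_mono) simp
    also have "\<dots> = ennreal (2 * (1/2)^n)"
      by (simp add: ennreal_mult[symmetric] power_mult_distrib[symmetric] mult.left_commute)
    finally show "(\<integral>\<^sup>+x. ennreal (2^n * (w n x - w (Suc n) x)\<^sup>2) \<partial>\<mu>) \<le> ennreal (2 * (1/2)^n)" .
  qed auto
  also have "\<dots> < \<infinity>"
    by (subst suminf_ennreal2) (auto intro!: summable_mult summable_geometric)
  finally have "AE x in \<mu>. (\<Sum>n. ennreal (2^n * (w n x - w (Suc n) x)\<^sup>2)) \<noteq> \<infinity>"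
    by (intro nn_integral_PInf_AE) auto
  then have conv_w: "AE x in \<mu>. convergent (\<lambda>n. exp (exponent (u n) x / 2))"
  proof eventually_elim
    case (elim x)
    then have "convergent (\<lambda>n. w n x)"
      by (intro convergent_if_weighted_square_sum_finite) simp
    then show ?case by (simp only: w_def)
  qed
  \<comment> \<open>This bound serves twice: it makes the lower limit finite almost everywhere, as
    \<open>convergent_exponent\<close> demands, and later it bounds the excess of the limit
    tuple.\<close>
  have fatou: "(\<integral>\<^sup>+x. liminf (\<lambda>n. ennreal (exp (exponent (u n) x) - exponent (u n) x)) \<partial>\<mu>) \<le> m"
  proof -
    have "(\<integral>\<^sup>+x. liminf (\<lambda>n. ennreal (exp (exponent (u n) x) - exponent (u n) x)) \<partial>\<mu>)
        \<le> liminf (\<lambda>n. excess (u n))"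
      unfolding excess_def by (rule nn_integral_liminf) measurable
    also have "\<dots> \<le> liminf (\<lambda>n. m + ennreal ((1/4)^n))"
      using u(2) by (intro Liminf_mono always_eventually allI less_imp_le)
    also have "(\<lambda>n. m + ennreal ((1/4)^n)) \<longlonglongrightarrow> m + ennreal 0"
      by (intro tendsto_intros tendsto_ennrealI LIMSEQ_realpow_zero) auto
    then have "liminf (\<lambda>n. m + ennreal ((1/4)^n)) = m"
      by (simp add: lim_imp_Liminf)
    finally show ?thesis .
  qed
  then have "AE x in \<mu>. liminf (\<lambda>n. ennreal (exp (exponent (u n) x) - exponent (u n) x)) \<noteq> \<infinity>"
    using m by (intro nn_integral_PInf_AE) auto
  with conv_w have conv: "AE x in \<mu>. convergent (\<lambda>n. exponent (u n) x)"
    by eventually_elim (rule convergent_exponent, auto simp: less_top)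
  then have "AE x in \<mu>. convergent (\<lambda>n. potential_sum (u n) x)"
  proof eventually_elim
    case (elim x)
    then have "convergent (\<lambda>n. \<epsilon> * exponent (u n) x + enn2real (c x))"
      by (intro convergent_add convergent_mult convergent_const)
    then show ?case using eps_pos by (simp add: exponent_def)
  qed
  then obtain v where v: "measurable_tuple v"
    "AE x in \<mu>. (\<lambda>n. potential_sum (u n) x) \<longlonglongrightarrow> potential_sum v x"
    by (rule potential_sum_limit[where u = u, OF meas])
  have "excess v = (\<integral>\<^sup>+x. liminf (\<lambda>n. ennreal (exp (exponent (u n) x) - exponent (u n) x)) \<partial>\<mu>)"
    unfolding excess_def
  proof (rule nn_integral_cong_AE)
    show "AE x in \<mu>. ennreal (exp (exponent v x) - exponent v x) =
        liminf (\<lambda>n. ennreal (exp (exponent (u n) x) - exponent (u n) x))"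
      using v(2)
    proof eventually_elim
      case (elim x)
      have "(\<lambda>n. exponent (u n) x) \<longlonglongrightarrow> exponent v x"
        unfolding exponent_def using eps_pos by (intro tendsto_intros elim) auto
      then have "(\<lambda>n. ennreal (exp (exponent (u n) x) - exponent (u n) x))
          \<longlonglongrightarrow> ennreal (exp (exponent v x) - exponent v x)"
        by (intro tendsto_ennrealI tendsto_intros)
      then show ?case by (simp add: lim_imp_Liminf)
    qed
  qed
  with fatou have le: "excess v \<le> m" by simp
  \<comment> \<open>The limit was obtained only as a measurable tuple; its finite excess makes it
    admissible.\<close>
  then have "L1_tuple N \<rho> v" using v(1) m by (intro finite_excess_imp_L1) (auto intro: order_le_less_trans)
  with le lower show ?thesis using order_trans by blast
qed

lemma dual_maximizer_exists: "\<exists>u. is_arg_max (dual_functional N \<rho> \<epsilon> c) (L1_tuple N \<rho>) u"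
  using excess_minimizer_exists by (simp add: is_arg_max_dual_iff)

section \<open>Uniqueness of dual maximizers\<close>

lemma excess_cong_AE:
  assumes "AE x in \<mu>. potential_sum u x = potential_sum v x"
  shows "excess u = excess v"
  unfolding excess_def using assms by (intro nn_integral_cong_AE) (auto simp: exponent_def)

text \<open>If both tuples are optimal, the midpoint bound with \<open>d = 0\<close> forces their
  exponentials to agree almost everywhere. Conversely, \<open>excess\<close> depends on a tuple only
  through its potential sum.\<close>

lemma dual_maximizer_iff:
  assumes u: "is_arg_max (dual_functional N \<rho> \<epsilon> c) (L1_tuple N \<rho>) u" and v: "L1_tuple N \<rho> v"
  shows "is_arg_max (dual_functional N \<rho> \<epsilon> c) (L1_tuple N \<rho>) v \<longleftrightarrow>
    (AE x in \<mu>. potential_sum u x = potential_sum v x)"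
proof
  have u': "L1_tuple N \<rho> u" and min: "\<And>w. L1_tuple N \<rho> w \<Longrightarrow> excess u \<le> excess w"
    using u by (auto simp: is_arg_max_dual_iff)
  note [measurable] = L1_imp_measurable_tuple[OF u'] L1_imp_measurable_tuple[OF v]
  have fin: "excess u < \<infinity>"
    using min[of "\<lambda>i t. 0"] excess_zero_finite by (auto simp: L1_tuple_def intro: order_le_less_trans)
  {
    assume "is_arg_max (dual_functional N \<rho> \<epsilon> c) (L1_tuple N \<rho>) v"
    then have "excess v \<le> excess u" using u' by (auto simp: is_arg_max_dual_iff)
    then have "excess u + excess v \<le> 2 * excess u + 0" by (simp add: mult_2 add_left_mono)
    from excess_midpoint_bound[OF u' v min fin this]
    have "(\<integral>\<^sup>+x. ennreal ((exp (exponent u x / 2) - exp (exponent v x / 2))\<^sup>2) \<partial>\<mu>) = 0" by simp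
    then have "AE x in \<mu>. ennreal ((exp (exponent u x / 2) - exp (exponent v x / 2))\<^sup>2) = 0"
      by (subst (asm) nn_integral_0_iff_AE) auto
    then show "AE x in \<mu>. potential_sum u x = potential_sum v x"
      by eventually_elim (use eps_pos in \<open>simp add: exponent_def\<close>)
  }
  assume "AE x in \<mu>. potential_sum u x = potential_sum v x"
  then show "is_arg_max (dual_functional N \<rho> \<epsilon> c) (L1_tuple N \<rho>) v"
    using v min excess_cong_AE by (auto simp: is_arg_max_dual_iff)
qed

section \<open>The Gibbs plan and the primal problem\<close>

text \<open>The counterpart of \<open>transport_plans\<close> with the product sigma-algebra in
  place of the Borel sets of the product topology; the final proof identifies the two.\<close>

definition coupling :: "(nat \<Rightarrow> 'a) measure \<Rightarrow> bool" where
  "coupling \<gamma> \<longleftrightarrow> sets \<gamma> = sets \<mu> \<and> prob_space \<gamma> \<and>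
    (\<forall>i\<in>{1..N}. distr \<gamma> (\<rho> i) (\<lambda>x. x i) = \<rho> i)"

abbreviation gibbs :: "(nat \<Rightarrow> 'a \<Rightarrow> real) \<Rightarrow> (nat \<Rightarrow> 'a) measure" where
  "gibbs u \<equiv> density \<mu> (gibbs_density N \<epsilon> c u)"

lemma gibbs_eq_density_exp:
  assumes [measurable]: "measurable_tuple u"
  shows "gibbs u = density \<mu> (\<lambda>x. ennreal (exp (exponent u x)))"
  using AE_gibbs_density_eq by (intro density_cong) measurable

section \<open>Optimality of the potentials and the marginals of the Gibbs plan\<close>

lemma finite_excess_imp_integrable_exp:
  assumes u: "L1_tuple N \<rho> u" and fin: "excess u < \<infinity>"
  shows "integrable \<mu> (\<lambda>x. exp (exponent u x))"
proof -
  note [measurable] = L1_imp_measurable_tuple[OF u]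
  have "integrable \<mu> (\<lambda>x. exp (exponent u x) - exponent u x)"
    using exponent_exp_minus_nonneg fin unfolding excess_def by (intro integrableI_nonneg) auto
  from Bochner_Integration.integrable_add[OF this integral_exponent(1)[OF u]] show ?thesis by simp
qed

lemma excess_eq_integral:
  assumes u: "L1_tuple N \<rho> u" and "integrable \<mu> (\<lambda>x. exp (exponent u x))"
  shows "excess u = ennreal ((\<integral>x. exp (exponent u x) \<partial>\<mu>) - (\<integral>x. exponent u x \<partial>\<mu>))"
    and "0 \<le> (\<integral>x. exp (exponent u x) \<partial>\<mu>) - (\<integral>x. exponent u x \<partial>\<mu>)"
proof -
  have eq: "(\<integral>x. exp (exponent u x) - exponent u x \<partial>\<mu>) =
      (\<integral>x. exp (exponent u x) \<partial>\<mu>) - (\<integral>x. exponent u x \<partial>\<mu>)"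
    using assms(2) integral_exponent(1)[OF u] by simp
  show "excess u = ennreal ((\<integral>x. exp (exponent u x) \<partial>\<mu>) - (\<integral>x. exponent u x \<partial>\<mu>))"
    unfolding excess_def eq[symmetric] using assms(2) integral_exponent(1)[OF u] exponent_exp_minus_nonneg
    by (intro nn_integral_eq_integral) auto
  show "0 \<le> (\<integral>x. exp (exponent u x) \<partial>\<mu>) - (\<integral>x. exponent u x \<partial>\<mu>)"
    unfolding eq[symmetric] using exponent_exp_minus_nonneg
    by (intro Bochner_Integration.integral_nonneg) auto
qed

lemma dual_maximizer_excess_finite:
  assumes "is_arg_max (dual_functional N \<rho> \<epsilon> c) (L1_tuple N \<rho>) u"
  shows "excess u < \<infinity>"
proof -
  have "L1_tuple N \<rho> (\<lambda>i t. 0)" by (simp add: L1_tuple_def)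
  then have "excess u \<le> excess (\<lambda>i t. 0)" using assms unfolding is_arg_max_dual_iff by blast
  then show ?thesis using excess_zero_finite by (rule order_le_less_trans)
qed

text \<open>Perturbing \<open>u i\<close> by a multiple of the indicator of \<open>A\<close> turns
  minimality into \<open>s * p \<le> (exp s - 1) * q\<close> for all real \<open>s\<close>, where
  \<open>p\<close> is the mass of \<open>A\<close> under \<open>\<rho> i\<close> and
  \<open>q\<close> its mass under the Gibbs marginal. Hence \<open>p = q\<close>.\<close>

lemma gibbs_marginal:
  assumes max: "is_arg_max (dual_functional N \<rho> \<epsilon> c) (L1_tuple N \<rho>) u" and i: "i \<in> {1..N}"
  shows "distr (gibbs u) (\<rho> i) (\<lambda>x. x i) = \<rho> i"
proof (rule measure_eqI)
  have u: "L1_tuple N \<rho> u" and min: "\<And>v. L1_tuple N \<rho> v \<Longrightarrow> excess u \<le> excess v"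
    using max unfolding is_arg_max_dual_iff by auto
  note [measurable] = L1_imp_measurable_tuple[OF u]
  note int_exp = finite_excess_imp_integrable_exp[OF u dual_maximizer_excess_finite[OF max]]
  have comp [measurable]: "(\<lambda>x. x i) \<in> \<mu> \<rightarrow>\<^sub>M \<rho> i" using i by (rule measurable_component_singleton)
  fix A assume "A \<in> sets (distr (gibbs u) (\<rho> i) (\<lambda>x. x i))"
  then have A [measurable]: "A \<in> sets (\<rho> i)" by simp
  define I where "I x = (indicator A (x i) :: real)" for x :: "nat \<Rightarrow> 'a"
  have [measurable]: "I \<in> borel_measurable \<mu>" unfolding I_def by measurable
  define q where "q = (\<integral>x. I x * exp (exponent u x) \<partial>\<mu>)"
  have int_q: "integrable \<mu> (\<lambda>x. I x * exp (exponent u x))"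
    by (rule Bochner_Integration.integrable_bound[OF int_exp])
       (auto simp: I_def indicator_def intro!: borel_measurable_times)
  have int_I: "integrable \<mu> I"
    by (rule P.integrable_const_bound[where B = 1]) (auto simp: I_def indicator_def)
  have p: "(\<integral>x. I x \<partial>\<mu>) = measure (\<rho> i) A"
  proof -
    have "(\<integral>x. I x \<partial>\<mu>) = (\<integral>t. indicator A t \<partial>distr \<mu> (\<rho> i) (\<lambda>x. x i))"
      unfolding I_def by (rule integral_distr[symmetric]) measurable
    also have "\<dots> = measure (\<rho> i) A"
      using A[THEN sets.sets_into_space] by (subst PiM_component[OF i]) (simp add: Int_absorb2)
    finally show ?thesis .
  qed
  have "s * measure (\<rho> i) A \<le> (exp s - 1) * q" for s
  proof -
    \<comment> \<open>The factor \<open>\<epsilon>\<close> cancels the division in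
      \<open>exponent\<close>, so the exponent moves by exactly \<open>s * I x\<close>.\<close>
    define v where "v = u(i := (\<lambda>t. u i t + \<epsilon> * s * indicator A t))"
    have "integrable (\<rho> i) (indicator A :: 'a \<Rightarrow> real)"
      by (rule M.integrable_const_bound[where B = 1]) auto
    then have v: "L1_tuple N \<rho> v"
      using u i unfolding L1_tuple_def v_def by simp
    have "potential_sum v x = potential_sum u x + \<epsilon> * s * I x" for x
    proof -
      have "(\<Sum>j\<in>{1..N} - {i}. v j (x j)) = (\<Sum>j\<in>{1..N} - {i}. u j (x j))"
        by (rule sum.cong) (auto simp: v_def)
      then show ?thesis
        unfolding potential_sum_def I_def using i by (simp add: sum.remove[of _ i] v_def)
    qed
    then have T: "exponent v x = exponent u x + s * I x" for x
      using eps_pos by (simp add: exponent_def field_simps)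
    \<comment> \<open>As \<open>I\<close> takes only the values 0 and 1, the perturbed exponential
      is affine in \<open>I\<close>. The integrals below are therefore explicit, and no
      differentiation under the integral sign occurs.\<close>
    have E: "exp (exponent v x) = exp (exponent u x) + (exp s - 1) * (I x * exp (exponent u x))" for x
      by (auto simp: T I_def indicator_def exp_add algebra_simps)
    have int_v: "integrable \<mu> (\<lambda>x. exp (exponent v x))"
      unfolding E using int_exp int_q by simp
    have "(\<integral>x. exp (exponent u x) \<partial>\<mu>) - (\<integral>x. exponent u x \<partial>\<mu>)
        \<le> (\<integral>x. exp (exponent v x) \<partial>\<mu>) - (\<integral>x. exponent v x \<partial>\<mu>)"
      using min[OF v] excess_eq_integral[OF u int_exp] excess_eq_integral[OF v int_v]
      by (simp add: ennreal_le_iff)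
    also have "\<dots> = (\<integral>x. exp (exponent u x) \<partial>\<mu>) + (exp s - 1) * q
        - ((\<integral>x. exponent u x \<partial>\<mu>) + s * measure (\<rho> i) A)"
    proof -
      have "(\<integral>x. exp (exponent v x) \<partial>\<mu>) = (\<integral>x. exp (exponent u x) \<partial>\<mu>) + (exp s - 1) * q"
        unfolding E q_def using int_exp int_q by simp
      moreover have "(\<integral>x. exponent v x \<partial>\<mu>) = (\<integral>x. exponent u x \<partial>\<mu>) + s * measure (\<rho> i) A"
        unfolding T p[symmetric] using int_I integral_exponent(1)[OF u] by simp
      ultimately show ?thesis by simp
    qed
    finally show ?thesis by simp
  qed
  then have pq: "measure (\<rho> i) A = q" by (rule eq_if_mult_le_exp_minus_one)
  have "emeasure (distr (gibbs u) (\<rho> i) (\<lambda>x. x i)) A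
      = (\<integral>\<^sup>+x. ennreal (exp (exponent u x)) * indicator ((\<lambda>x. x i) -` A \<inter> space \<mu>) x \<partial>\<mu>)"
    unfolding gibbs_eq_density_exp[OF L1_imp_measurable_tuple[OF u]]
    by (subst emeasure_distr) (auto intro!: emeasure_density)
  also have "\<dots> = (\<integral>\<^sup>+x. ennreal (I x * exp (exponent u x)) \<partial>\<mu>)"
    by (rule nn_integral_cong) (auto simp: I_def indicator_def)
  also have "\<dots> = ennreal q"
    unfolding q_def using int_q by (intro nn_integral_eq_integral) (auto simp: I_def)
  finally show "emeasure (distr (gibbs u) (\<rho> i) (\<lambda>x. x i)) A = emeasure (\<rho> i) A"
    by (simp add: M.emeasure_eq_measure pq)
qed simp

text \<open>Total mass one is inherited from the marginal at index \<open>1\<close>, which is a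
  probability measure.\<close>

lemma gibbs_coupling:
  assumes max: "is_arg_max (dual_functional N \<rho> \<epsilon> c) (L1_tuple N \<rho>) u"
  shows "coupling (gibbs u)"
  unfolding coupling_def
proof (intro conjI ballI)
  have 1: "1 \<in> {1..N}" using N_pos by simp
  have "(\<lambda>x. x 1) \<in> gibbs u \<rightarrow>\<^sub>M \<rho> 1"
    using measurable_component_singleton[OF 1, of \<rho>] by simp
  moreover have "prob_space (distr (gibbs u) (\<rho> 1) (\<lambda>x. x 1))"
    unfolding gibbs_marginal[OF max 1] by (rule prob_space)
  ultimately show "prob_space (gibbs u)" by (rule prob_space_distrD)
qed (use gibbs_marginal[OF max] in auto)

section \<open>The primal cost as the dual value plus an integrated Fenchel-Young gap\<close>

definition entropy_gap :: "(nat \<Rightarrow> 'a \<Rightarrow> real) \<Rightarrow> ((nat \<Rightarrow> 'a) \<Rightarrow> real) \<Rightarrow> (nat \<Rightarrow> 'a) \<Rightarrow> real" where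
  "entropy_gap u h x = h x * ln (h x) - h x * exponent u x - h x + exp (exponent u x)"

text \<open>The derivative of a probability measure is finite almost everywhere, so passing to real
  values with \<open>enn2real\<close> loses nothing.\<close>

lemma coupling_density:
  assumes \<gamma>: "coupling \<gamma>" and ac: "absolutely_continuous \<mu> \<gamma>"
  defines "h \<equiv> \<lambda>x. enn2real (RN_deriv \<mu> \<gamma> x)"
  shows "\<gamma> = density \<mu> (\<lambda>x. ennreal (h x))"
proof -
  have sets: "sets \<gamma> = sets \<mu>" and prob: "prob_space \<gamma>" using \<gamma> by (auto simp: coupling_def)
  interpret G: prob_space \<gamma> by fact
  have "AE x in \<mu>. RN_deriv \<mu> \<gamma> x \<noteq> \<infinity>"
    by (rule P.RN_deriv_finite[OF _ ac sets]) unfold_locales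
  then have "density \<mu> (RN_deriv \<mu> \<gamma>) = density \<mu> (\<lambda>x. ennreal (h x))"
    by (intro density_cong) (auto simp: h_def less_top elim!: eventually_mono)
  with P.density_RN_deriv[OF ac sets] show ?thesis by simp
qed

text \<open>Both \<open>h\<close> and \<open>exp (exponent u)\<close> have integral one, so the last
  two terms of the gap cancel after integration. What remains is the entropy minus the integral of
  the exponent under \<open>\<gamma>\<close>, which the marginals of \<open>\<gamma>\<close> split
  into the potentials and the cost.\<close>

lemma primal_functional_eq:
  assumes u: "L1_tuple N \<rho> u" and gibbs: "coupling (gibbs u)"
    and \<gamma>: "coupling \<gamma>" and ac: "absolutely_continuous \<mu> \<gamma>"
  defines "h \<equiv> \<lambda>x. enn2real (RN_deriv \<mu> \<gamma> x)"
  shows "(\<integral>\<^sup>+x. c x \<partial>\<gamma>) < \<infinity> \<Longrightarrow> (\<integral>\<^sup>+x. ennreal (h x * ln (h x)) \<partial>\<mu>) < \<infinity> \<Longrightarrow>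
      integrable \<mu> (entropy_gap u h) \<and> primal_functional N \<rho> \<epsilon> c \<gamma> =
        ereal ((\<Sum>i\<in>{1..N}. \<integral>x. u i x \<partial>\<rho> i) + \<epsilon> * (\<integral>x. entropy_gap u h x \<partial>\<mu>))"
    and "\<not> ((\<integral>\<^sup>+x. c x \<partial>\<gamma>) < \<infinity> \<and> (\<integral>\<^sup>+x. ennreal (h x * ln (h x)) \<partial>\<mu>) < \<infinity>) \<Longrightarrow>
      primal_functional N \<rho> \<epsilon> c \<gamma> = \<infinity>"
proof -
  note [measurable] = L1_imp_measurable_tuple[OF u]
  have sets: "sets \<gamma> = sets \<mu>" using \<gamma> by (simp add: coupling_def)
  interpret G: prob_space \<gamma> using \<gamma> by (simp add: coupling_def)
  have dens: "\<gamma> = density \<mu> (\<lambda>x. ennreal (h x))"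
    unfolding h_def by (rule coupling_density[OF \<gamma> ac])
  have h [measurable]: "h \<in> borel_measurable \<mu>" unfolding h_def by measurable
  have h_nonneg: "h x \<ge> 0" for x by (simp add: h_def)
  have int_h: "integrable \<mu> h" "(\<integral>x. h x \<partial>\<mu>) = 1"
  proof -
    have "(\<integral>\<^sup>+x. 1 \<partial>\<gamma>) = 1" by (simp add: G.emeasure_space_1)
    then have "(\<integral>\<^sup>+x. ennreal (h x) \<partial>\<mu>) = 1" unfolding dens by (subst (asm) nn_integral_density) auto
    then show "integrable \<mu> h" "(\<integral>x. h x \<partial>\<mu>) = 1"
      using nn_integral_eq_integrable[of h \<mu> 1] h_nonneg by auto
  qed
  have int_e: "integrable \<mu> (\<lambda>x. exp (exponent u x))" "(\<integral>x. exp (exponent u x) \<partial>\<mu>) = 1"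
  proof -
    interpret Gu: prob_space "gibbs u" using gibbs by (simp add: coupling_def)
    have "(\<integral>\<^sup>+x. 1 \<partial>gibbs u) = 1" using Gu.emeasure_space_1 by simp
    then have "(\<integral>\<^sup>+x. ennreal (exp (exponent u x)) \<partial>\<mu>) = 1"
      unfolding gibbs_eq_density_exp[OF L1_imp_measurable_tuple[OF u]]
      by (subst (asm) nn_integral_density) auto
    then show "integrable \<mu> (\<lambda>x. exp (exponent u x))" "(\<integral>x. exp (exponent u x) \<partial>\<mu>) = 1"
      using nn_integral_eq_integrable[of "\<lambda>x. exp (exponent u x)" \<mu> 1] by auto
  qed
  \<comment> \<open>Since \<open>h ln h \<ge> h - 1 \<ge> -1\<close>, the entropy cannot be minus
    infinity and no difference of two infinities arises.\<close>
  have neg: "(\<integral>\<^sup>+x. ennreal (- (h x * ln (h x))) \<partial>\<mu>) < \<infinity>"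
  proof -
    have "(\<integral>\<^sup>+x. ennreal (- (h x * ln (h x))) \<partial>\<mu>) \<le> (\<integral>\<^sup>+x. 1 \<partial>\<mu>)"
    proof (intro nn_integral_mono)
      fix x
      have "- (h x * ln (h x)) \<le> 1" using mult_ln_ge[OF h_nonneg[of x]] h_nonneg[of x] by linarith
      then show "ennreal (- (h x * ln (h x))) \<le> 1" by (metis ennreal_1 ennreal_leI)
    qed
    then show ?thesis by (simp add: P.emeasure_space_1 order_le_less_trans)
  qed
  have ent: "rel_entropy \<gamma> \<mu> = enn2ereal (\<integral>\<^sup>+x. ennreal (h x * ln (h x)) \<partial>\<mu>)
      - enn2ereal (\<integral>\<^sup>+x. ennreal (- (h x * ln (h x))) \<partial>\<mu>)"
    using ac by (simp add: rel_entropy_def h_def Let_def)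
  {
    assume "\<not> ((\<integral>\<^sup>+x. c x \<partial>\<gamma>) < \<infinity> \<and> (\<integral>\<^sup>+x. ennreal (h x * ln (h x)) \<partial>\<mu>) < \<infinity>)"
    then show "primal_functional N \<rho> \<epsilon> c \<gamma> = \<infinity>"
      unfolding primal_functional_def ent using neg eps_pos
      by (cases "\<integral>\<^sup>+x. c x \<partial>\<gamma>"; cases "\<integral>\<^sup>+x. ennreal (h x * ln (h x)) \<partial>\<mu>";
          cases "\<integral>\<^sup>+x. ennreal (- (h x * ln (h x))) \<partial>\<mu>") (auto simp: enn2ereal_ennreal)
  }
  assume cfin: "(\<integral>\<^sup>+x. c x \<partial>\<gamma>) < \<infinity>" and pos: "(\<integral>\<^sup>+x. ennreal (h x * ln (h x)) \<partial>\<mu>) < \<infinity>"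
  have int_hlnh: "integrable \<mu> (\<lambda>x. h x * ln (h x))"
    unfolding real_integrable_def using pos neg by (simp add: less_top)
  have ent': "rel_entropy \<gamma> \<mu> = ereal (\<integral>x. h x * ln (h x) \<partial>\<mu>)"
    unfolding ent real_lebesgue_integral_def[OF int_hlnh] using pos neg
    by (cases "\<integral>\<^sup>+x. ennreal (h x * ln (h x)) \<partial>\<mu>"; cases "\<integral>\<^sup>+x. ennreal (- (h x * ln (h x))) \<partial>\<mu>")
       (auto simp: enn2ereal_ennreal)
  have c\<gamma> [measurable]: "c \<in> borel_measurable \<gamma>"
    using cost_measurable unfolding measurable_cong_sets[OF sets refl] .
  have "AE x in \<gamma>. c x \<noteq> \<infinity>" using nn_integral_PInf_AE[OF c\<gamma>] cfin by simp
  then have c_eq: "(\<integral>\<^sup>+x. c x \<partial>\<gamma>) = (\<integral>\<^sup>+x. ennreal (enn2real (c x)) \<partial>\<gamma>)"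
    by (intro nn_integral_cong_AE) (auto simp: less_top elim!: eventually_mono)
  then have int_c: "integrable \<gamma> (\<lambda>x. enn2real (c x))"
    using cfin by (intro integrableI_nonneg) auto
  then have c_eq': "(\<integral>\<^sup>+x. c x \<partial>\<gamma>) = ennreal (\<integral>x. enn2real (c x) \<partial>\<gamma>)"
    unfolding c_eq by (intro nn_integral_eq_integral) auto
  have marg: "distr \<gamma> (\<rho> i) (\<lambda>x. x i) = \<rho> i" if "i \<in> {1..N}" for i
    using \<gamma> that unfolding coupling_def by blast
  have S: "integrable \<gamma> (potential_sum u)"
    "(\<integral>x. potential_sum u x \<partial>\<gamma>) = (\<Sum>i\<in>{1..N}. \<integral>x. u i x \<partial>\<rho> i)"
    by (rule integral_potential_sum[OF sets marg u]; assumption)+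
  have T: "integrable \<gamma> (exponent u)"
    "(\<integral>x. exponent u x \<partial>\<gamma>) = ((\<Sum>i\<in>{1..N}. \<integral>x. u i x \<partial>\<rho> i) - (\<integral>x. enn2real (c x) \<partial>\<gamma>)) / \<epsilon>"
    using S int_c by (auto simp: exponent_def[abs_def])
  have hT: "integrable \<mu> (\<lambda>x. h x * exponent u x)"
    "(\<integral>x. h x * exponent u x \<partial>\<mu>) = (\<integral>x. exponent u x \<partial>\<gamma>)"
  proof -
    show "integrable \<mu> (\<lambda>x. h x * exponent u x)"
      using T(1) h_nonneg unfolding dens by (subst (asm) integrable_density) auto
    show "(\<integral>x. h x * exponent u x \<partial>\<mu>) = (\<integral>x. exponent u x \<partial>\<gamma>)"
      using h_nonneg unfolding dens by (subst integral_density) auto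
  qed
  have gap: "integrable \<mu> (entropy_gap u h)"
    "(\<integral>x. entropy_gap u h x \<partial>\<mu>) = (\<integral>x. h x * ln (h x) \<partial>\<mu>) - (\<integral>x. exponent u x \<partial>\<gamma>)"
    using int_hlnh hT int_h int_e by (auto simp: entropy_gap_def[abs_def])
  moreover have "primal_functional N \<rho> \<epsilon> c \<gamma> =
      ereal ((\<integral>x. enn2real (c x) \<partial>\<gamma>) + \<epsilon> * (\<integral>x. h x * ln (h x) \<partial>\<mu>))"
    unfolding primal_functional_def c_eq' ent' by (simp add: enn2ereal_ennreal)
  moreover have "(\<integral>x. enn2real (c x) \<partial>\<gamma>) + \<epsilon> * (\<integral>x. h x * ln (h x) \<partial>\<mu>) =
      (\<Sum>i\<in>{1..N}. \<integral>x. u i x \<partial>\<rho> i) + \<epsilon> * (\<integral>x. entropy_gap u h x \<partial>\<mu>)"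
    unfolding gap(2) T(2) using eps_pos by (simp add: field_simps)
  ultimately show "integrable \<mu> (entropy_gap u h) \<and> primal_functional N \<rho> \<epsilon> c \<gamma> =
        ereal ((\<Sum>i\<in>{1..N}. \<integral>x. u i x \<partial>\<rho> i) + \<epsilon> * (\<integral>x. entropy_gap u h x \<partial>\<mu>))"
    by simp
qed

text \<open>The gap is pointwise nonnegative, which gives the lower bound. Attaining the bound
  forces the gap to vanish almost everywhere, and the equality case of \<open>exp_ge_mult_ln\<close>
  then identifies the density.\<close>

lemma primal_functional_ge:
  assumes u: "L1_tuple N \<rho> u" and gibbs: "coupling (gibbs u)" and \<gamma>: "coupling \<gamma>"
  shows "ereal (\<Sum>i\<in>{1..N}. \<integral>x. u i x \<partial>\<rho> i) \<le> primal_functional N \<rho> \<epsilon> c \<gamma>"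
    and "primal_functional N \<rho> \<epsilon> c \<gamma> \<le> ereal (\<Sum>i\<in>{1..N}. \<integral>x. u i x \<partial>\<rho> i) \<Longrightarrow> \<gamma> = gibbs u"
proof -
  note [measurable] = L1_imp_measurable_tuple[OF u]
  define h where "h x = enn2real (RN_deriv \<mu> \<gamma> x)" for x
  define V where "V = (\<Sum>i\<in>{1..N}. \<integral>x. u i x \<partial>\<rho> i)"
  have h_nonneg: "h x \<ge> 0" for x by (simp add: h_def)
  have [measurable]: "h \<in> borel_measurable \<mu>" unfolding h_def by measurable
  have gap_nonneg: "0 \<le> entropy_gap u h x" for x
    unfolding entropy_gap_def by (rule exp_ge_mult_ln(1)[OF h_nonneg])
  note eq = primal_functional_eq[OF u gibbs \<gamma>, folded h_def V_def]
  have dichotomy: "primal_functional N \<rho> \<epsilon> c \<gamma> = \<infinity> \<or> (absolutely_continuous \<mu> \<gamma> \<and>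
      integrable \<mu> (entropy_gap u h) \<and>
      primal_functional N \<rho> \<epsilon> c \<gamma> = ereal (V + \<epsilon> * (\<integral>x. entropy_gap u h x \<partial>\<mu>)))"
  proof (cases "absolutely_continuous \<mu> \<gamma>")
    case True
    show ?thesis
    proof (cases "(\<integral>\<^sup>+x. c x \<partial>\<gamma>) < \<infinity> \<and> (\<integral>\<^sup>+x. ennreal (h x * ln (h x)) \<partial>\<mu>) < \<infinity>")
      case False
      with eq(2)[OF True] show ?thesis by simp
    next
      case fin: True
      with eq(1)[OF True] True show ?thesis by simp
    qed
  next
    case False
    then have "primal_functional N \<rho> \<epsilon> c \<gamma> = \<infinity>"
      using eps_pos by (simp add: primal_functional_def rel_entropy_def)
    then show ?thesis ..
  qed
  have gap_integral: "0 \<le> (\<integral>x. entropy_gap u h x \<partial>\<mu>)"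
    using gap_nonneg by (rule Bochner_Integration.integral_nonneg)
  then have "0 \<le> \<epsilon> * (\<integral>x. entropy_gap u h x \<partial>\<mu>)" using eps_pos by simp
  with dichotomy show "ereal V \<le> primal_functional N \<rho> \<epsilon> c \<gamma>"
    by (elim disjE conjE) simp_all
  assume "primal_functional N \<rho> \<epsilon> c \<gamma> \<le> ereal V"
  with dichotomy have ac: "absolutely_continuous \<mu> \<gamma>" and int: "integrable \<mu> (entropy_gap u h)"
    and "\<epsilon> * (\<integral>x. entropy_gap u h x \<partial>\<mu>) \<le> 0"
    by (elim disjE conjE; simp)+
  then have "(\<integral>x. entropy_gap u h x \<partial>\<mu>) = 0"
    using gap_integral eps_pos by (simp add: mult_le_0_iff)
  moreover have "AE x in \<mu>. 0 \<le> entropy_gap u h x" using gap_nonneg by (rule AE_I2)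
  \<comment> \<open>Integrability of the gap is essential here: the Bochner integral of a
    nonintegrable function is zero by default.\<close>
  ultimately have "AE x in \<mu>. entropy_gap u h x = 0"
    using integral_nonneg_eq_0_iff_AE[OF int] by blast
  then have "AE x in \<mu>. ennreal (h x) = ennreal (exp (exponent u x))"
  proof eventually_elim
    case (elim x)
    from exp_ge_mult_ln(2)[OF h_nonneg elim[unfolded entropy_gap_def]] show ?case by simp
  qed
  then have "density \<mu> (\<lambda>x. ennreal (h x)) = gibbs u"
    unfolding gibbs_eq_density_exp[OF L1_imp_measurable_tuple[OF u]]
    by (intro density_cong) measurable
  then show "\<gamma> = gibbs u"
    using coupling_density[OF \<gamma> ac] by (simp add: h_def)
qed

text \<open>The gap vanishes for \<open>h = exp (exponent u)\<close>, so the task is to show that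
  the cost and the positive part of the entropy are finite. Both are controlled by
  \<open>exp (exponent u x) * potential_sum u x\<close>, which is integrable because the Gibbs plan
  has the right marginals.\<close>

lemma primal_functional_gibbs:
  assumes u: "L1_tuple N \<rho> u" and gibbs: "coupling (gibbs u)"
  shows "primal_functional N \<rho> \<epsilon> c (gibbs u) = ereal (\<Sum>i\<in>{1..N}. \<integral>x. u i x \<partial>\<rho> i)"
proof -
  note [measurable] = L1_imp_measurable_tuple[OF u]
  define h where "h x = enn2real (RN_deriv \<mu> (gibbs u) x)" for x
  have ac: "absolutely_continuous \<mu> (gibbs u)" by (rule absolutely_continuousI_density) measurable
  have "AE x in \<mu>. gibbs_density N \<epsilon> c u x = RN_deriv \<mu> (gibbs u) x"
    by (rule P.RN_deriv_unique) auto
  with AE_gibbs_density_eq[of u] have h: "AE x in \<mu>. h x = exp (exponent u x)"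
    by eventually_elim (metis enn2real_ennreal exp_ge_zero h_def)
  have eS: "integrable \<mu> (\<lambda>x. exp (exponent u x) * potential_sum u x)"
  proof -
    have "integrable (gibbs u) (potential_sum u)"
      using gibbs unfolding coupling_def by (intro integral_potential_sum(1)[OF _ _ u]) blast+
    then show ?thesis
      unfolding gibbs_eq_density_exp[OF L1_imp_measurable_tuple[OF u]]
      by (subst (asm) integrable_density) auto
  qed
  \<comment> \<open>The integrable product splits into an entropy part and a cost part. Each is
    bounded below, the cost part by zero, so each is also bounded above in terms of the
    product.\<close>
  have eT: "exp (exponent u x) * potential_sum u x =
      \<epsilon> * (exp (exponent u x) * exponent u x) + exp (exponent u x) * enn2real (c x)" for x
    using eps_pos by (simp add: exponent_def field_simps)
  have "(\<integral>\<^sup>+x. c x \<partial>gibbs u) = (\<integral>\<^sup>+x. ennreal (exp (exponent u x)) * c x \<partial>\<mu>)"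
    unfolding gibbs_eq_density_exp[OF L1_imp_measurable_tuple[OF u]]
    by (rule nn_integral_density) measurable
  also have "\<dots> \<le> (\<integral>\<^sup>+x. ennreal (norm (exp (exponent u x) * potential_sum u x + \<epsilon>)) \<partial>\<mu>)"
  proof (rule nn_integral_mono_AE)
    show "AE x in \<mu>. ennreal (exp (exponent u x)) * c x
        \<le> ennreal (norm (exp (exponent u x) * potential_sum u x + \<epsilon>))"
      using AE_cost_finite
    proof eventually_elim
      case (elim x)
      \<comment> \<open>This is \<open>h ln h \<ge> h - 1\<close> at the exponential; the entropy
        part is thus at least \<open>- \<epsilon>\<close>, whence the added
        \<open>\<epsilon>\<close> in the bound.\<close>
      have "- 1 \<le> exp (exponent u x) * exponent u x"
        using mult_ln_ge[of "exp (exponent u x)"] exp_gt_zero[of "exponent u x"]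
        unfolding ln_exp by linarith
      from mult_left_mono[OF this, of \<epsilon>] have
        "exp (exponent u x) * enn2real (c x) \<le> norm (exp (exponent u x) * potential_sum u x + \<epsilon>)"
        unfolding eT real_norm_def using eps_pos by linarith
      moreover have "ennreal (exp (exponent u x)) * c x = ennreal (exp (exponent u x) * enn2real (c x))"
        using elim by (simp add: ennreal_mult less_top)
      ultimately show ?case by (simp add: ennreal_leI)
    qed
  qed
  also have "\<dots> < \<infinity>"
    using Bochner_Integration.integrable_add[OF eS P.integrable_const[of \<epsilon>]]
    unfolding integrable_iff_bounded by simp
  finally have cfin: "(\<integral>\<^sup>+x. c x \<partial>gibbs u) < \<infinity>" .
  have "(\<integral>\<^sup>+x. ennreal (h x * ln (h x)) \<partial>\<mu>)
      \<le> (\<integral>\<^sup>+x. ennreal (norm (exp (exponent u x) * potential_sum u x / \<epsilon>)) \<partial>\<mu>)"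
  proof (rule nn_integral_mono_AE)
    show "AE x in \<mu>. ennreal (h x * ln (h x)) \<le> ennreal (norm (exp (exponent u x) * potential_sum u x / \<epsilon>))"
      using h
    proof eventually_elim
      case (elim x)
      have "0 \<le> exp (exponent u x) * enn2real (c x) / \<epsilon>" using eps_pos by simp
      then have "exp (exponent u x) * exponent u x \<le> exp (exponent u x) * potential_sum u x / \<epsilon>"
        unfolding eT using eps_pos by (simp add: add_divide_distrib)
      also have "\<dots> \<le> norm (exp (exponent u x) * potential_sum u x / \<epsilon>)"
        unfolding real_norm_def by (rule abs_ge_self)
      finally show ?case unfolding elim ln_exp by (rule ennreal_leI)
    qed
  qed
  also have "\<dots> < \<infinity>"
    using integrable_divide[OF eS, of \<epsilon>] unfolding integrable_iff_bounded by simp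
  finally have "primal_functional N \<rho> \<epsilon> c (gibbs u) =
      ereal ((\<Sum>i\<in>{1..N}. \<integral>x. u i x \<partial>\<rho> i) + \<epsilon> * (\<integral>x. entropy_gap u h x \<partial>\<mu>))"
    using primal_functional_eq(1)[OF u gibbs gibbs ac cfin] by (simp only: h_def[abs_def])
  moreover have "(\<integral>x. entropy_gap u h x \<partial>\<mu>) = (\<integral>x. 0 \<partial>\<mu>)"
  proof (rule integral_cong_AE)
    show "entropy_gap u h \<in> borel_measurable \<mu>"
      unfolding entropy_gap_def h_def by measurable
    show "AE x in \<mu>. entropy_gap u h x = 0"
      using h by eventually_elim (simp add: entropy_gap_def)
  qed simp
  ultimately show ?thesis by simp
qed

lemma primal_minimizer_iff:
  assumes max: "is_arg_max (dual_functional N \<rho> \<epsilon> c) (L1_tuple N \<rho>) u"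
  shows "is_arg_min (primal_functional N \<rho> \<epsilon> c) coupling \<gamma> \<longleftrightarrow> \<gamma> = gibbs u"
proof -
  have u: "L1_tuple N \<rho> u" using max unfolding is_arg_max_def by blast
  note gibbs = gibbs_coupling[OF max]
  note val = primal_functional_gibbs[OF u gibbs]
  show ?thesis
  proof
    assume "is_arg_min (primal_functional N \<rho> \<epsilon> c) coupling \<gamma>"
    then have "coupling \<gamma>" "primal_functional N \<rho> \<epsilon> c \<gamma> \<le> primal_functional N \<rho> \<epsilon> c (gibbs u)"
      using gibbs by (auto simp: is_arg_min_def not_less)
    then show "\<gamma> = gibbs u" using primal_functional_ge(2)[OF u gibbs] val by simp
  next
    assume "\<gamma> = gibbs u"
    then show "is_arg_min (primal_functional N \<rho> \<epsilon> c) coupling \<gamma>"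
      using gibbs primal_functional_ge(1)[OF u gibbs] by (simp add: is_arg_min_def val not_less)
  qed
qed

end

section \<open>From the topological hypotheses to the measure-theoretic setting and back\<close>

theorem theorem5p8:
  fixes N :: nat
    and X :: "nat \<Rightarrow> 'a topology"
    and \<rho> :: "nat \<Rightarrow> 'a measure"
    and c :: "(nat \<Rightarrow> 'a) \<Rightarrow> ennreal"
    and K :: ennreal
    and \<epsilon> :: real
  assumes "N \<ge> 2"
    and "\<And>i. i \<in> {1..N} \<Longrightarrow> polish_topology (X i)"
    and "\<And>i. i \<in> {1..N} \<Longrightarrow> borel_prob_on (X i) (\<rho> i)"
    and "lower_semicontinuous_on (product_topology X {1..N}) c"
    and "K < \<infinity>"
    and "\<And>i. i \<in> {1..N} \<Longrightarrow>
           (SUP t\<in>topspace (X i). \<integral>\<^sup>+y. c (y(i := t)) \<partial>PiM ({1..N} - {i}) \<rho>) \<le> K"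
    and "\<epsilon> > 0"
  shows "(\<exists>u. is_arg_max (dual_functional N \<rho> \<epsilon> c) (L1_tuple N \<rho>) u) \<and>
    (\<forall>u. is_arg_max (dual_functional N \<rho> \<epsilon> c) (L1_tuple N \<rho>) u \<longrightarrow>
       (\<forall>v. L1_tuple N \<rho> v \<longrightarrow>
          (is_arg_max (dual_functional N \<rho> \<epsilon> c) (L1_tuple N \<rho>) v \<longleftrightarrow>
           (\<exists>a :: nat \<Rightarrow> real. (\<Sum>i\<in>{1..N}. a i) = 0 \<and>
              (\<forall>i\<in>{1..N}. AE x in \<rho> i. v i x = u i x + a i)))) \<and>
       density (PiM {1..N} \<rho>) (gibbs_density N \<epsilon> c u) \<in> transport_plans N X \<rho> \<and>
       (\<forall>\<gamma>. is_arg_min (primal_functional N \<rho> \<epsilon> c) (\<lambda>\<gamma>. \<gamma> \<in> transport_plans N X \<rho>) \<gamma> \<longleftrightarrow>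
            \<gamma> = density (PiM {1..N} \<rho>) (gibbs_density N \<epsilon> c u)))"
proof -
  note One_nat_def [simp del]
  have one: "1 \<in> {1..N}" using assms(1) by simp
  have prob: "prob_space (\<rho> i)" and sets: "sets (\<rho> i) = sets (borel_of (X i))" if "i \<in> {1..N}" for i
    using assms(3)[OF that] by (auto simp: borel_prob_on_def)
  have sets_PiM: "sets (PiM {1..N} \<rho>) = sets (borel_of (product_topology X {1..N}))"
  proof -
    have "sets (PiM {1..N} \<rho>) = sets (PiM {1..N} (\<lambda>i. borel_of (X i)))"
      using sets by (rule sets_PiM_cong[OF refl])
    also have "\<dots> = sets (borel_of (product_topology X {1..N}))"
      by (rule sets_borel_of_product_topology[symmetric])
        (simp_all only: finite_atLeastAtMost polish_imp_second_countable assms(2))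
    finally show ?thesis .
  qed
  \<comment> \<open>\<open>product_prob_space\<close> asks for probability measures at all indices, not only in \<open>{1..N}\<close>.\<close>
  define r where "r i = (if i \<in> {1..N} then \<rho> i else \<rho> 1)" for i
  have r: "r i = \<rho> i" if "i \<in> {1..N}" for i
    using that by (simp add: r_def)
  have PiM_r: "PiM J r = PiM J \<rho>" if "J \<subseteq> {1..N}" for J
    using that by (intro PiM_cong) (auto simp: r)
  have cost: "c \<in> borel_measurable (PiM {1..N} r)"
    unfolding PiM_r[OF order_refl] measurable_cong_sets[OF sets_PiM refl]
    by (rule lower_semicontinuous_on_borel_measurable[OF assms(4)])
  interpret P: product_prob_space r "{1..N}"
    by (rule product_prob_spaceI) (use prob one in \<open>auto simp: r_def\<close>)
  \<comment> \<open>Splitting off coordinate \<open>1\<close> exhibits the total cost as the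
    integral over \<open>r 1\<close> of a partial integral that is bounded by
    \<open>K\<close>.\<close>
  have insert: "insert 1 ({1..N} - {1}) = {1..N}" using one by blast
  have "(\<integral>\<^sup>+x. c x \<partial>PiM {1..N} r) =
      (\<integral>\<^sup>+t. (\<integral>\<^sup>+y. c (y(1 := t)) \<partial>PiM ({1..N} - {1}) \<rho>) \<partial>r 1)"
    using P.product_nn_integral_insert_rev[of "{1..N} - {1}" 1 c] cost
    unfolding insert PiM_r[OF Diff_subset] by simp
  also have "\<dots> \<le> (\<integral>\<^sup>+t. K \<partial>r 1)"
  proof (rule nn_integral_mono)
    fix t assume "t \<in> space (r 1)"
    then have "t \<in> topspace (X 1)"
      using sets_eq_imp_space_eq[OF sets[OF one]] r[OF one] by simp
    then have "(\<integral>\<^sup>+y. c (y(1 := t)) \<partial>PiM ({1..N} - {1}) \<rho>) \<le>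
        (SUP t\<in>topspace (X 1). \<integral>\<^sup>+y. c (y(1 := t)) \<partial>PiM ({1..N} - {1}) \<rho>)"
      by (rule SUP_upper)
    also note assms(6)[OF one]
    finally show "(\<integral>\<^sup>+y. c (y(1 := t)) \<partial>PiM ({1..N} - {1}) \<rho>) \<le> K" .
  qed
  also have "\<dots> = K" by (simp add: P.M.emeasure_space_1)
  finally have cost_fin: "(\<integral>\<^sup>+x. c x \<partial>PiM {1..N} r) < \<infinity>"
    using assms(5) by (rule order_le_less_trans)
  interpret E: entropic_transport N r \<epsilon> c
    by unfold_locales (use assms(1,7) cost cost_fin in auto)
  \<comment> \<open>The next equations carry the results from \<open>r\<close> back to
    \<open>\<rho>\<close>; the two families agree on \<open>{1..N}\<close>.\<close>
  have L1: "L1_tuple N r = L1_tuple N \<rho>"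
    by (auto simp: fun_eq_iff L1_tuple_def r)
  have dual: "dual_functional N r \<epsilon> c = dual_functional N \<rho> \<epsilon> c"
  proof
    fix u :: "nat \<Rightarrow> 'a \<Rightarrow> real"
    have "(\<Sum>i\<in>{1..N}. \<integral>x. u i x \<partial>r i) = (\<Sum>i\<in>{1..N}. \<integral>x. u i x \<partial>\<rho> i)"
      by (rule sum.cong) (simp_all only: r)
    then show "dual_functional N r \<epsilon> c u = dual_functional N \<rho> \<epsilon> c u"
      unfolding dual_functional_def PiM_r[OF order_refl] by (simp only:)
  qed
  have primal: "primal_functional N r \<epsilon> c = primal_functional N \<rho> \<epsilon> c"
    unfolding primal_functional_def[abs_def] PiM_r[OF order_refl] ..
  \<comment> \<open>By \<open>sets_PiM\<close>, being a Borel measure on the product topology means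
    having the sigma-algebra of \<open>PiM\<close>.\<close>
  have plans: "E.coupling = (\<lambda>\<gamma>. \<gamma> \<in> transport_plans N X \<rho>)"
    unfolding E.coupling_def[abs_def] transport_plans_def borel_prob_on_def PiM_r[OF order_refl] sets_PiM
    using r by (auto simp: fun_eq_iff)
  have AE_r: "(\<forall>i\<in>{1..N}. AE x in r i. Q i x) \<longleftrightarrow> (\<forall>i\<in>{1..N}. AE x in \<rho> i. Q i x)" for Q
    by (intro ball_cong refl) (simp only: r)
  show ?thesis
  proof (intro conjI allI impI)
    show "\<exists>u. is_arg_max (dual_functional N \<rho> \<epsilon> c) (L1_tuple N \<rho>) u"
      using E.dual_maximizer_exists unfolding L1 dual .
  next
    fix u v
    assume u: "is_arg_max (dual_functional N \<rho> \<epsilon> c) (L1_tuple N \<rho>) u" and v: "L1_tuple N \<rho> v"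
    show "is_arg_max (dual_functional N \<rho> \<epsilon> c) (L1_tuple N \<rho>) v \<longleftrightarrow>
        (\<exists>a. (\<Sum>i\<in>{1..N}. a i) = 0 \<and> (\<forall>i\<in>{1..N}. AE x in \<rho> i. v i x = u i x + a i))"
      using E.dual_maximizer_iff[unfolded L1 dual, OF u v, unfolded E.potential_sum_AE_eq_iff]
      by (simp only: AE_r)
  next
    fix u assume "is_arg_max (dual_functional N \<rho> \<epsilon> c) (L1_tuple N \<rho>) u"
    from E.gibbs_coupling[unfolded L1 dual, OF this]
    show "density (PiM {1..N} \<rho>) (gibbs_density N \<epsilon> c u) \<in> transport_plans N X \<rho>"
      unfolding plans PiM_r[OF order_refl] .
  next
    fix u \<gamma> assume "is_arg_max (dual_functional N \<rho> \<epsilon> c) (L1_tuple N \<rho>) u"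
    from E.primal_minimizer_iff[unfolded L1 dual, OF this, of \<gamma>]
    show "is_arg_min (primal_functional N \<rho> \<epsilon> c) (\<lambda>\<gamma>. \<gamma> \<in> transport_plans N X \<rho>) \<gamma> \<longleftrightarrow>
        \<gamma> = density (PiM {1..N} \<rho>) (gibbs_density N \<epsilon> c u)"
      unfolding plans primal PiM_r[OF order_refl] .
  qed
qed

end
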